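(* For the finite impulse response model $Y=\Phi\theta+V$ described in the context, under the input, noise and independence assumptions stated there, the following hold. 1) For any given $\eta\in\mathbb R^p$ and $k=1,\dots,p$, as $N\to\infty$, $$\sqrt N(\Phi^T\Phi)^{-1}\overset{a.s.}\to0,\qquad \hat S(\eta)^{-1}\overset{a.s.}\to P(\eta)^{-1},\qquad \sqrt N\left(\hat S(\eta)^{-1}-P(\eta)^{-1}\right)\overset{a.s.}\to0,$$ $$\frac{\partial\hat S(\eta)^{-1}}{\partial\eta_k}\overset{a.s.}\to\frac{\partial P(\eta)^{-1}}{\partial\eta_k},\qquad \sqrt N\left(\frac{\partial\hat S(\eta)^{-1}}{\partial\eta_k}-\frac{\partial P(\eta)^{-1}}{\partial\eta_k}\right)\overset{a.s.}\to0,$$ where $\eta_k$ denotes the $k$th element of $\eta$. 2) Suppose that $\hat\eta_N\overset{a.s.}\to\eta^*$ as $N\to\infty$. If there exists a compact set $\widetilde\Omega$ containing $\eta^*$ such that $P(\eta)$ is continuous for every $\eta\in\widetilde\Omega$ and $\|\hat S(\eta)^{-1}\|_F<\|P(\eta)^{-1}\|_F$ is bounded (that is, there is a constant $M>0$ with $\|\hat S(\eta)^{-1}\|_F<\|P(\eta)^{-1}\|_F\le M$ for any $\eta\in\widetilde\Omega$), then as $N\to\infty$ $$\hat S(\hat\eta_N)^{-1}\overset{a.s.}\to P(\eta^* )^{-1}.$$ 3) Suppose that $\hat\eta_N\overset{a.s.}\to\eta^*$ as $N\to\infty$. If $P(\eta)$ is differentiable for every $\eta\in\Omega$, then $$\hat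 S(\hat\eta_N)^{-1}-P(\eta^* )^{-1}=-\hat S(\hat\eta_N)^{-1}\left[\sum_{k=1}^p\left.\frac{\partial P(\eta)}{\partial\eta_k}\right|_{\eta=\tilde\eta_N}e_k^T(\hat\eta_N-\eta^* )\right]P(\eta^* )^{-1}-\widehat{\sigma^2}\hat S(\hat\eta_N)^{-1}(\Phi^T\Phi)^{-1}P(\eta^* )^{-1},$$ where $e_k\in\mathbb R^p$ denotes the column vector with $k$th element one and others zero, and $\tilde\eta_N$ belongs to a neighborhood of $\eta^*$ with radius $\|\hat\eta_N-\eta^*\|_2$. In particular, if $P=\eta I_n$ with $\eta>0$, then $$\hat S(\hat\eta_N)^{-1}-P(\eta^* )^{-1}=-(\hat\eta_N-\eta^* )\hat S(\hat\eta_N)^{-1}P(\eta^* )^{-1}-\widehat{\sigma^2}\hat S(\hat\eta_N)^{-1}(\Phi^T\Phi)^{-1}P(\eta^* )^{-1}.$$ 4) We have $$\hat S(\eta)^{-1}-P(\eta)^{-1}=-\frac1N\widehat{\sigma^2}\,\hat S(\eta)^{-1}N(\Phi^T\Phi)^{-1}P(\eta)^{-1},$$ and for $k,l=1,\dots,p$, $$\frac{\partial P(\eta)^{-1}}{\partial\eta_k}=-P(\eta)^{-1}\frac{\partial P(\eta)}{\partial\eta_k}P(\eta)^{-1},\qquad \frac{\partial\hat S(\eta)^{-1}}{\partial\eta_k}=-\hat S(\eta)^{-1}\frac{\partial P(\eta)}{\partial\eta_k}\hat S(\eta)^{-1},$$ $$\frac{\partial^2P(\eta)^{-1}}{\partial\eta_k\partial\eta_l}=P(\eta)^{-1}\frac{\partial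 P(\eta)}{\partial\eta_l}P(\eta)^{-1}\frac{\partial P(\eta)}{\partial\eta_k}P(\eta)^{-1}-P(\eta)^{-1}\frac{\partial^2P(\eta)}{\partial\eta_k\partial\eta_l}P(\eta)^{-1}+P(\eta)^{-1}\frac{\partial P(\eta)}{\partial\eta_k}P(\eta)^{-1}\frac{\partial P(\eta)}{\partial\eta_l}P(\eta)^{-1},$$ $$\frac{\partial^2\hat S(\eta)^{-1}}{\partial\eta_k\partial\eta_l}=\hat S(\eta)^{-1}\frac{\partial P(\eta)}{\partial\eta_l}\hat S(\eta)^{-1}\frac{\partial P(\eta)}{\partial\eta_k}\hat S(\eta)^{-1}-\hat S(\eta)^{-1}\frac{\partial^2P(\eta)}{\partial\eta_k\partial\eta_l}\hat S(\eta)^{-1}+\hat S(\eta)^{-1}\frac{\partial P(\eta)}{\partial\eta_k}\hat S(\eta)^{-1}\frac{\partial P(\eta)}{\partial\eta_l}\hat S(\eta)^{-1}.$$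
   Context: Model: $y(t)=\sum_{i=1}^n g_iu(t-i)+v(t)$, $t=1,\dots,N$, where $n$ is the fixed order, $N>n$ the sample size, and $u(t),y(t),v(t)\in\mathbb R$ are the input, output and disturbance. In matrix form $Y=\Phi\theta+V$ with $Y=[y(1),\dots,y(N)]^T$, $\Phi=[\phi(1),\dots,\phi(N)]^T\in\mathbb R^{N\times n}$, $\phi(t)=[u(t-1),\dots,u(t-n)]^T$, $\theta=[g_1,\dots,g_n]^T$ and $V=[v(1),\dots,v(N)]^T$; the true value of $\theta$ is a fixed $\theta_0\in\mathbb R^n$. $\Phi$ is assumed to have full column rank, $\mathrm{rank}(\Phi)=n$. Let $\hat\theta^{\mathrm{LS}}=(\Phi^T\Phi)^{-1}\Phi^TY$ be the least squares estimator and $\widehat{\sigma^2}=\|Y-\Phi\hat\theta^{\mathrm{LS}}\|_2^2/(N-n)$. Input assumption: for $t=1-n,\dots,N-1$, $u(t)=\sum_{k=0}^\infty h(k)e(t-k)$ with $\sum_{k=0}^\infty|h(k)|<\infty$, where $e(t)$ is i.i.d. with zero mean, variance $\sigma_e^2>0$, bounded moments of order $4+\delta$ for some $\delta>0$, and $\mathbb E[e^4(t)]=c\sigma_e^4$ with $c\in\mathbb R$ a constant. The covariance matrix $\Sigma\in\mathbb R^{n\times n}$ of $[u(0),u(1),\dots,u(n-1)]^T$ is positive definite. Noise assumption: $v(t)$ is i.i.d. with zero mean, variance $\sigma^2>0$ and bounded moments of order $4+\delta$ for some $\delta>0$. Independence assumption: $\{u(t)\}_{t=1-n}^{N-1}$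 and $\{v(t)\}_{t=1}^N$ are mutually independent, which means that for $i=1-n,\dots,N-1$ and $j=1,\dots,N$, $u(i)$ and $v(j)$ are independent. Kernel matrix: $P=P(\eta)\in\mathbb R^{n\times n}$ is positive semidefinite, with $(i,j)$th element $\kappa(i,j;\eta)$ given by a positive semidefinite kernel $\kappa(\cdot,\cdot;\eta):\mathbb N\times\mathbb N\to\mathbb R$ with hyper-parameter $\eta=(\eta_1,\dots,\eta_p)\in\Omega\subset\mathbb R^p$. It is understood that $\eta$ lies in the set $\Omega$ where $P$ is defined, that $P(\eta)$ is invertible where its inverse appears, and that $P$ is (twice) differentiable where its first (second) order derivatives appear. Define $\hat S(\eta)=P(\eta)+\widehat{\sigma^2}(\Phi^T\Phi)^{-1}$. $\hat\eta_N$ is a random (data-dependent) value of the hyper-parameter and $\eta^*$ its limit. $\|\cdot\|_F$ is the Frobenius norm, $\|\cdot\|_2$ the Euclidean norm of a vector, $I_n$ the $n\times n$ identity matrix, and $\overset{a.s.}\to$ denotes almost sure convergence.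
   Formalization: In part 3 the intermediate point may differ for each matrix entry (a single one need not exist for n≥2), and the expansion is claimed when the segment from η* to the estimate lies in Ω (it can fail for disconnected Ω). *)

theory Defs
  imports "HOL-Probability.Probability"
begin

text \<open>
  The order \<open>n\<close> is \<open>CARD('n)\<close>, and \<open>idx\<close> enumerates the index type \<open>'n\<close> by \<open>1, \<dots>, n\<close>.
  The sample size \<open>N\<close> varies, so the regression matrix \<open>\<Phi>\<close> (with \<open>N\<close> rows) is represented by
  the sequence of its rows \<open>\<phi>(1), \<dots>, \<phi>(N)\<close>; products such as \<open>\<Phi>\<^sup>T \<Phi>\<close> are written as the sums over
  the rows to which they unfold.
\<close>

definition regressor ::
  "('n \<Rightarrow> nat) \<Rightarrow> (int \<Rightarrow> 'a \<Rightarrow> real) \<Rightarrow> nat \<Rightarrow> 'a \<Rightarrow> real ^ 'n::finite" where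
  "regressor idx u t \<omega> = (\<chi> i. u (int t - int (idx i)) \<omega>)"

text \<open>\<open>\<Phi>\<^sup>T \<Phi>\<close>\<close>
definition gram ::
  "('n \<Rightarrow> nat) \<Rightarrow> (int \<Rightarrow> 'a \<Rightarrow> real) \<Rightarrow> nat \<Rightarrow> 'a \<Rightarrow> real ^ 'n ^ 'n::finite" where
  "gram idx u N \<omega> = (\<chi> i j. \<Sum>t=1..N. regressor idx u t \<omega> $ i * regressor idx u t \<omega> $ j)"

text \<open>\<open>rank \<Phi> = n\<close>; the library defines the rank of a matrix as the dimension of its set of rows.\<close>
definition full_column_rank ::
  "('n::finite \<Rightarrow> nat) \<Rightarrow> (int \<Rightarrow> 'a \<Rightarrow> real) \<Rightarrow> nat \<Rightarrow> 'a \<Rightarrow> bool" where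
  "full_column_rank idx u N \<omega> \<longleftrightarrow> dim ((\<lambda>t. regressor idx u t \<omega>) ` {1..N}) = CARD('n)"

definition ls_estimate ::
  "('n \<Rightarrow> nat) \<Rightarrow> (int \<Rightarrow> 'a \<Rightarrow> real) \<Rightarrow> (nat \<Rightarrow> 'a \<Rightarrow> real) \<Rightarrow> nat \<Rightarrow> 'a \<Rightarrow> real ^ 'n::finite" where
  "ls_estimate idx u y N \<omega> =
     matrix_inv (gram idx u N \<omega>) *v (\<Sum>t=1..N. y t \<omega> *\<^sub>R regressor idx u t \<omega>)"

definition noise_var_estimate ::
  "('n::finite \<Rightarrow> nat) \<Rightarrow> (int \<Rightarrow> 'a \<Rightarrow> real) \<Rightarrow> (nat \<Rightarrow> 'a \<Rightarrow> real) \<Rightarrow> nat \<Rightarrow> 'a \<Rightarrow> real" where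
  "noise_var_estimate idx u y N \<omega> =
     (\<Sum>t=1..N. (y t \<omega> - regressor idx u t \<omega> \<bullet> ls_estimate idx u y N \<omega>)\<^sup>2)
       / (real N - real CARD('n))"

definition S_hat ::
  "('h \<Rightarrow> real ^ 'n ^ 'n) \<Rightarrow> ('n::finite \<Rightarrow> nat) \<Rightarrow> (int \<Rightarrow> 'a \<Rightarrow> real) \<Rightarrow> (nat \<Rightarrow> 'a \<Rightarrow> real)
     \<Rightarrow> nat \<Rightarrow> 'a \<Rightarrow> 'h \<Rightarrow> real ^ 'n ^ 'n" where
  "S_hat P idx u y N \<omega> \<eta> =
     P \<eta> + noise_var_estimate idx u y N \<omega> *\<^sub>R matrix_inv (gram idx u N \<omega>)"

definition pos_def :: "real ^ 'n ^ 'n::finite \<Rightarrow> bool" where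
  "pos_def A \<longleftrightarrow> transpose A = A \<and> (\<forall>x. x \<noteq> 0 \<longrightarrow> 0 < x \<bullet> (A *v x))"

definition psd_kernel_on :: "'i set \<Rightarrow> ('i \<Rightarrow> 'i \<Rightarrow> real) \<Rightarrow> bool" where
  "psd_kernel_on I K \<longleftrightarrow>
     (\<forall>i\<in>I. \<forall>j\<in>I. K i j = K j i) \<and>
     (\<forall>F c. finite F \<and> F \<subseteq> I \<longrightarrow> 0 \<le> (\<Sum>i\<in>F. \<Sum>j\<in>F. c i * c j * K i j))"

definition iid :: "'a measure \<Rightarrow> ('i \<Rightarrow> 'a \<Rightarrow> real) \<Rightarrow> 'i set \<Rightarrow> bool" where
  "iid M X I \<longleftrightarrow>
     prob_space.indep_vars M (\<lambda>_. borel) X I \<and>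
     (\<forall>i\<in>I. \<forall>j\<in>I. distr M borel (X i) = distr M borel (X j))"

definition bounded_moments :: "'a measure \<Rightarrow> ('i \<Rightarrow> 'a \<Rightarrow> real) \<Rightarrow> 'i set \<Rightarrow> real \<Rightarrow> bool" where
  "bounded_moments M X I q \<longleftrightarrow>
     (\<exists>C. \<forall>i\<in>I. integrable M (\<lambda>\<omega>. \<bar>X i \<omega>\<bar> powr q) \<and> (\<integral>\<omega>. \<bar>X i \<omega>\<bar> powr q \<partial>M) \<le> C)"

definition covariance_matrix :: "'a measure \<Rightarrow> ('n \<Rightarrow> 'a \<Rightarrow> real) \<Rightarrow> real ^ 'n ^ 'n::finite" where
  "covariance_matrix M X =
     (\<chi> i j. \<integral>\<omega>. (X i \<omega> - (\<integral>\<omega>'. X i \<omega>' \<partial>M)) * (X j \<omega> - (\<integral>\<omega>'. X j \<omega>' \<partial>M)) \<partial>M)"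

definition partial :: "'p::finite \<Rightarrow> (real ^ 'p \<Rightarrow> 'b::real_normed_vector) \<Rightarrow> real ^ 'p \<Rightarrow> 'b" where
  "partial k F \<eta> = vector_derivative (\<lambda>s. F (\<eta> + s *\<^sub>R axis k 1)) (at 0)"

text \<open>Differentiability of the Frechet derivative, expressed through its coordinates.\<close>
definition twice_differentiable_at ::
  "(real ^ 'p::finite \<Rightarrow> 'b::real_normed_vector) \<Rightarrow> real ^ 'p \<Rightarrow> bool" where
  "twice_differentiable_at F \<eta> \<longleftrightarrow>
     (\<forall>\<^sub>F x in nhds \<eta>. F differentiable (at x)) \<and> (\<forall>k. partial k F differentiable (at \<eta>))"

end

theory Submission
  imports Defs "HOL-Library.Discrete_Functions"
begin

text \<open>
  The algebraic identities all come from the resolvent identity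
  \<open>A\<inverse> - B\<inverse> = - A\<inverse> (A - B) B\<inverse>\<close> (\<open>matrix_inv_diff\<close>). Applied to two nearby values of a
  matrix function it gives the derivative of the inverse; applied to \<open>A = S\<close> and \<open>B = P\<close>, which
  differ by \<open>\<sigma>\<^sup>2 (\<Phi>\<^sup>T \<Phi>)\<inverse>\<close> with the estimated \<open>\<sigma>\<^sup>2\<close>, it reduces every limit to the two rates
  \<open>\<surd>N (\<Phi>\<^sup>T \<Phi>)\<inverse> \<longlonglongrightarrow> 0\<close> and
  \<open>\<surd>N \<sigma>\<^sup>2 (\<Phi>\<^sup>T \<Phi>)\<inverse> \<longlonglongrightarrow> 0\<close> almost surely (\<open>inv_gram_rates\<close>). The expansion around the limit
  \<open>\<eta>\<^sup>*\<close> adds the mean value theorem, which for a matrix function holds entry by entry, with one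
  intermediate point per entry (\<open>mean_value_matrix\<close>).

  For these rates, two orders of growth are compared. Since least squares minimizes the residual,
  the estimated variance is at most \<open>\<Sum>t\<le>N. v(t)\<^sup>2\<close> divided by \<open>N - n\<close>, and this sum is
  \<open>o(N\<^bsup>3/2\<^esup>)\<close> almost surely, because \<open>\<Sum>t. v(t)\<^sup>2 / t\<^bsup>3/2\<^esup>\<close> has finite expectation
  (\<open>AE_sum_squares_negligible\<close>). On the other side \<open>\<Phi>\<^sup>T \<Phi>\<close> is bounded below by a positive multiple
  of \<open>N I\<close>, so that its inverse is \<open>O(1/N)\<close>.

  The lower bound on \<open>\<Phi>\<^sup>T \<Phi>\<close> is the probabilistic core. Its entries are sums of products of the
  linear process \<open>u\<close>, that is, weighted sums over lags \<open>k, l\<close> of the sums over \<open>t\<close> of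
  \<open>e(t - k) e(t - l)\<close>. For fixed lags the centred products are uncorrelated in \<open>t\<close>, so their sum over
  \<open>N\<close> times has second moment at most \<open>C N\<close>, with the same \<open>C\<close> for all lags
  (\<open>expectation_sum_centred_product_square\<close>). As the weights are summable, the Cauchy-Schwarz
  inequality and Fatou's lemma carry this bound to the linear process itself
  (\<open>sum_product_second_moment\<close>). Dividing by \<open>N\<close> and taking \<open>N = m\<^sup>2\<close>, the second moments of the errors
  are summable in \<open>m\<close>, hence the sample covariances converge almost surely along the squares, and the
  limit is the covariance matrix \<open>\<Sigma>\<close> of the input (\<open>AE_gram_limit\<close>). Positive definiteness of
  \<open>\<Sigma>\<close> gives the lower bound at squares. The quadratic form of \<open>\<Phi>\<^sup>T \<Phi>\<close> is nondecreasing in \<open>N\<close> and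
  consecutive squares have bounded ratio, so the bound extends to all \<open>N\<close>
  (\<open>gram_coercive_of_squares\<close>).
\<close>

section \<open>Multiplication and inversion of real matrices\<close>

lemma bounded_bilinear_matrix_mult:
  "bounded_bilinear ((**) :: real^'m^'n \<Rightarrow> real^'k^'m \<Rightarrow> real^'k^'n)"
proof -
  have "bilinear ((**) :: real^'m^'n \<Rightarrow> real^'k^'m \<Rightarrow> real^'k^'n)"
    unfolding bilinear_def
    by (auto intro!: linearI
        simp: matrix_matrix_mult_def vec_eq_iff algebra_simps sum.distrib sum_distrib_left)
  then show ?thesis
    by (simp add: bilinear_conv_bounded_bilinear)
qed

lemmas matrix_mult_diff_left = bounded_bilinear.diff_left [OF bounded_bilinear_matrix_mult]
lemmas matrix_mult_diff_right = bounded_bilinear.diff_right [OF bounded_bilinear_matrix_mult]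
lemmas matrix_mult_add_left = bounded_bilinear.add_left [OF bounded_bilinear_matrix_mult]
lemmas matrix_mult_add_right = bounded_bilinear.add_right [OF bounded_bilinear_matrix_mult]
lemmas matrix_mult_scaleR_left = bounded_bilinear.scaleR_left [OF bounded_bilinear_matrix_mult]
lemmas matrix_mult_scaleR_right = bounded_bilinear.scaleR_right [OF bounded_bilinear_matrix_mult]
lemmas matrix_mult_minus_left = bounded_bilinear.minus_left [OF bounded_bilinear_matrix_mult]
lemmas matrix_mult_minus_right = bounded_bilinear.minus_right [OF bounded_bilinear_matrix_mult]
lemmas matrix_mult_zero_left = bounded_bilinear.zero_left [OF bounded_bilinear_matrix_mult]
lemmas matrix_mult_zero_right = bounded_bilinear.zero_right [OF bounded_bilinear_matrix_mult]
lemmas tendsto_matrix_mult = bounded_bilinear.tendsto [OF bounded_bilinear_matrix_mult]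

lemma matrix_inv_mult:
  fixes A :: "real^'n^'n"
  assumes "invertible A"
  shows "A ** matrix_inv A = mat 1" "matrix_inv A ** A = mat 1"
  using someI_ex[OF assms[unfolded invertible_def]] by (simp_all add: matrix_inv_def)

lemma matrix_inv_diff:
  fixes A B :: "real^'n^'n"
  assumes "invertible A" "invertible B"
  shows "matrix_inv A - matrix_inv B = - (matrix_inv A ** (A - B) ** matrix_inv B)"
proof -
  have "matrix_inv A ** (A - B) ** matrix_inv B
      = matrix_inv A ** A ** matrix_inv B - matrix_inv A ** (B ** matrix_inv B)"
    by (simp add: matrix_mult_diff_left matrix_mult_diff_right matrix_mul_assoc)
  also have "\<dots> = matrix_inv B - matrix_inv A"
    using assms by (simp add: matrix_inv_mult)
  finally show ?thesis by simp
qed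

lemma tendsto_det:
  fixes A :: "'x \<Rightarrow> real^'n^'n"
  assumes "(A \<longlongrightarrow> B) F"
  shows "((\<lambda>x. det (A x)) \<longlongrightarrow> det B) F"
  unfolding det_def by (intro tendsto_intros assms)

text \<open>
  The determinant is continuous and does not vanish at \<open>B\<close>, hence not near \<open>B\<close>
  either.
\<close>
lemma eventually_invertible:
  fixes A :: "'x \<Rightarrow> real^'n^'n"
  assumes "(A \<longlongrightarrow> B) F" "invertible B"
  shows "\<forall>\<^sub>F x in F. invertible (A x)"
proof -
  have "\<forall>\<^sub>F x in F. det (A x) \<noteq> 0"
    by (rule tendsto_imp_eventually_ne[OF tendsto_det[OF assms(1)]])
       (use assms(2) in \<open>simp add: invertible_det_nz\<close>)
  then show ?thesis by (simp add: invertible_det_nz)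
qed

text \<open>
  By \<open>matrix_inv_diff\<close>, the distance of the inverses is at most a constant times
  \<open>norm (matrix_inv (A x)) * norm (A x - B)\<close>. The first factor is itself the unknown;
  once \<open>A x\<close> is so close to \<open>B\<close> that the remaining factors have product below
  1/2, the same inequality bounds it by \<open>2 * norm (matrix_inv B)\<close>.
\<close>
lemma tendsto_matrix_inv:
  fixes A :: "'x \<Rightarrow> real^'n^'n"
  assumes lim: "(A \<longlongrightarrow> B) F" and B: "invertible B"
  shows "((\<lambda>x. matrix_inv (A x)) \<longlongrightarrow> matrix_inv B) F"
proof -
  obtain K where K: "K > 0"
    "\<And>(X :: real^'n^'n) (Y :: real^'n^'n). norm (X ** Y) \<le> norm X * norm Y * K"
    using bounded_bilinear.pos_bounded[OF bounded_bilinear_matrix_mult] by blast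
  define b where "b = norm (matrix_inv B)"
  have d0: "((\<lambda>x. norm (A x - B)) \<longlongrightarrow> 0) F"
    using lim by (simp add: LIM_zero tendsto_norm_zero)
  have "((\<lambda>x. norm (A x - B) * (K * K * b)) \<longlongrightarrow> 0) F"
    by (rule tendsto_mult_left_zero[OF d0])
  \<comment> \<open>The threshold 1/2 makes the inequality \<open>?a \<le> b + ?a / 2\<close> below solvable for
    \<open>?a\<close>.\<close>
  then have "\<forall>\<^sub>F x in F. norm (A x - B) * (K * K * b) < 1/2"
    by (rule order_tendstoD) simp
  moreover have "\<forall>\<^sub>F x in F. invertible (A x)"
    using lim B by (rule eventually_invertible)
  ultimately have "\<forall>\<^sub>F x in F. norm (matrix_inv (A x) - matrix_inv B)
      \<le> (2 * b) * (norm (A x - B) * (K * K * b))"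
  proof eventually_elim
    case (elim x)
    let ?a = "norm (matrix_inv (A x))" and ?d = "norm (A x - B)"
    have "norm (matrix_inv (A x) ** (A x - B) ** matrix_inv B)
        \<le> norm (matrix_inv (A x) ** (A x - B)) * b * K"
      unfolding b_def by (rule K(2))
    also have "\<dots> \<le> (?a * ?d * K) * b * K"
      using K by (intro mult_right_mono) (auto simp: b_def)
    finally have diff: "norm (matrix_inv (A x) - matrix_inv B) \<le> ?a * (?d * (K * K * b))"
      using matrix_inv_diff[OF elim(2) B] by (simp add: ac_simps)
    have "?a \<le> b + norm (matrix_inv (A x) - matrix_inv B)"
      unfolding b_def by (metis add.commute norm_triangle_sub)
    also have "\<dots> \<le> b + ?a * (1/2)"
      using diff mult_left_mono[OF less_imp_le[OF elim(1)], of ?a] by auto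
    finally have "?a \<le> 2 * b" by simp
    then have "?a * (?d * (K * K * b)) \<le> (2 * b) * (?d * (K * K * b))"
      by (rule mult_right_mono) (auto simp: b_def)
    with diff show ?case by linarith
  qed
  then have "((\<lambda>x. matrix_inv (A x) - matrix_inv B) \<longlongrightarrow> 0) F"
    by (rule Lim_null_comparison) (intro tendsto_mult_right_zero tendsto_mult_left_zero d0)
  then show ?thesis by (rule LIM_zero_cancel)
qed

text \<open>
  A perturbation that is small compared to \<open>1 / sqrt N\<close> changes the inverse of
  \<open>A\<close> by an amount that is again small compared to \<open>1 / sqrt N\<close>: the inverse
  of the perturbed matrix converges, and \<open>matrix_inv_diff\<close> expresses the change as a product
  in which only the perturbation carries the rate.
\<close>
lemma matrix_inv_perturbation_limit:
  fixes A :: "real^'n^'n" and R :: "nat \<Rightarrow> real^'n^'n"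
  assumes A: "invertible A" and R: "(\<lambda>N. sqrt (real N) *\<^sub>R R N) \<longlonglongrightarrow> 0"
  shows "(\<lambda>N. matrix_inv (A + R N)) \<longlonglongrightarrow> matrix_inv A"
    and "(\<lambda>N. sqrt (real N) *\<^sub>R (matrix_inv (A + R N) - matrix_inv A)) \<longlonglongrightarrow> 0"
    and "\<forall>\<^sub>F N in sequentially. invertible (A + R N)"
    and "R \<longlonglongrightarrow> 0"
proof -
  show R0: "R \<longlonglongrightarrow> 0"
  proof (rule Lim_null_comparison)
    show "\<forall>\<^sub>F N in sequentially. norm (R N) \<le> norm (sqrt (real N) *\<^sub>R R N)"
      using eventually_ge_at_top[of 1]
    proof eventually_elim
      case (elim N)
      then have "1 \<le> sqrt (real N)" by simp
      from mult_right_mono[OF this norm_ge_zero[of "R N"]] show ?case by simp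
    qed
    show "(\<lambda>N. norm (sqrt (real N) *\<^sub>R R N)) \<longlonglongrightarrow> 0"
      using R by (rule tendsto_norm_zero)
  qed
  then have AR: "(\<lambda>N. A + R N) \<longlonglongrightarrow> A"
    using tendsto_add[OF tendsto_const[of A] R0] by simp
  show inv: "\<forall>\<^sub>F N in sequentially. invertible (A + R N)"
    using AR A by (rule eventually_invertible)
  show lim: "(\<lambda>N. matrix_inv (A + R N)) \<longlonglongrightarrow> matrix_inv A"
    using AR A by (rule tendsto_matrix_inv)
  have "(\<lambda>N. - (matrix_inv (A + R N) ** (sqrt (real N) *\<^sub>R R N) ** matrix_inv A))
      \<longlonglongrightarrow> - (matrix_inv A ** 0 ** matrix_inv A)"
    by (intro tendsto_minus tendsto_matrix_mult lim R tendsto_const)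
  then have "(\<lambda>N. - (matrix_inv (A + R N) ** (sqrt (real N) *\<^sub>R R N) ** matrix_inv A)) \<longlonglongrightarrow> 0"
    by (simp add: matrix_mult_zero_left matrix_mult_zero_right)
  moreover have "\<forall>\<^sub>F N in sequentially. - (matrix_inv (A + R N) ** (sqrt (real N) *\<^sub>R R N) ** matrix_inv A)
      = sqrt (real N) *\<^sub>R (matrix_inv (A + R N) - matrix_inv A)"
    using inv by eventually_elim
      (simp add: matrix_inv_diff[OF _ A] matrix_mult_scaleR_left matrix_mult_scaleR_right)
  ultimately show "(\<lambda>N. sqrt (real N) *\<^sub>R (matrix_inv (A + R N) - matrix_inv A)) \<longlonglongrightarrow> 0"
    by (rule Lim_transform_eventually)
qed

text \<open>
  The derivative of \<open>A\<inverse>\<close> in a direction \<open>D\<close> is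
  \<open>- A\<inverse> D A\<inverse>\<close>. For such products the rate follows from
  \<open>X D X - A D A = (X - A) D X + A D (X - A)\<close>.
\<close>
lemma sandwiched_product_rate:
  fixes X :: "nat \<Rightarrow> real^'n^'n"
  assumes X: "X \<longlonglongrightarrow> A" and rate: "(\<lambda>N. sqrt (real N) *\<^sub>R (X N - A)) \<longlonglongrightarrow> 0"
  shows "(\<lambda>N. sqrt (real N) *\<^sub>R (X N ** D ** X N - A ** D ** A)) \<longlonglongrightarrow> 0"
proof -
  have "(\<lambda>N. sqrt (real N) *\<^sub>R (X N - A) ** D ** X N + A ** D ** (sqrt (real N) *\<^sub>R (X N - A)))
      \<longlonglongrightarrow> 0 ** D ** A + A ** D ** 0"
    by (intro tendsto_add tendsto_matrix_mult rate X tendsto_const)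
  moreover have "sqrt (real N) *\<^sub>R (X N - A) ** D ** X N + A ** D ** (sqrt (real N) *\<^sub>R (X N - A))
      = sqrt (real N) *\<^sub>R (X N ** D ** X N - A ** D ** A)" for N
    by (simp add: matrix_mult_scaleR_left matrix_mult_scaleR_right matrix_mult_diff_left
        matrix_mult_diff_right scaleR_diff_right)
  ultimately show ?thesis
    by (simp add: matrix_mult_zero_left matrix_mult_zero_right)
qed

section \<open>Partial derivatives of an inverse matrix and the mean value theorem\<close>

text \<open>
  The difference quotient form of the derivative, in which the resolvent identity can be substituted
  directly.
\<close>
lemma has_vector_derivative_at_0_iff:
  "(f has_vector_derivative D) (at 0) \<longleftrightarrow> ((\<lambda>s. (f s - f 0) /\<^sub>R s) \<longlongrightarrow> D) (at 0)"
proof -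
  have *: "norm (f s - f 0 - s *\<^sub>R D) / norm s = norm ((f s - f 0) /\<^sub>R s - D)" if "s \<noteq> 0" for s :: real
  proof -
    have "(f s - f 0) /\<^sub>R s - D = (f s - f 0 - s *\<^sub>R D) /\<^sub>R s"
      using that by (simp add: scaleR_diff_right)
    then show ?thesis by (simp add: divide_inverse_commute)
  qed
  have "(f has_vector_derivative D) (at 0)
      \<longleftrightarrow> ((\<lambda>s. norm (f s - f 0 - s *\<^sub>R D) / norm s) \<longlongrightarrow> 0) (at 0)"
    unfolding has_vector_derivative_def has_derivative_iff_norm
    by (simp add: bounded_linear_scaleR_left)
  also have "\<dots> \<longleftrightarrow> ((\<lambda>s. norm ((f s - f 0) /\<^sub>R s - D)) \<longlongrightarrow> 0) (at 0)"
    using *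
    by (intro filterlim_cong refl) (simp only: eventually_at_filter, intro always_eventually allI impI)
  also have "\<dots> \<longleftrightarrow> ((\<lambda>s. (f s - f 0) /\<^sub>R s) \<longlongrightarrow> D) (at 0)"
    by (simp only: tendsto_norm_zero_iff LIM_zero_iff)
  finally show ?thesis .
qed

text \<open>
  By \<open>matrix_inv_diff\<close> the difference quotient of the inverse is
  \<open>- F(s)\<inverse> ((F(s) - F(0)) / s) F(0)\<inverse>\<close>, and each factor converges.
\<close>
lemma has_vector_derivative_matrix_inv:
  fixes F :: "real \<Rightarrow> real^'n^'n"
  assumes F: "(F has_vector_derivative D) (at 0)" and inv: "invertible (F 0)"
  shows "((\<lambda>s. matrix_inv (F s)) has_vector_derivative
           - (matrix_inv (F 0) ** D ** matrix_inv (F 0))) (at 0)"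
proof -
  have cont: "(F \<longlongrightarrow> F 0) (at 0)"
    using has_vector_derivative_continuous[OF F] by (simp add: continuous_within)
  have "((\<lambda>s. - (matrix_inv (F s) ** ((F s - F 0) /\<^sub>R s) ** matrix_inv (F 0)))
      \<longlongrightarrow> - (matrix_inv (F 0) ** D ** matrix_inv (F 0))) (at 0)"
    using F[unfolded has_vector_derivative_at_0_iff] cont inv
    by (intro tendsto_minus tendsto_matrix_mult tendsto_matrix_inv tendsto_const)
  moreover have "\<forall>\<^sub>F s in at 0. - (matrix_inv (F s) ** ((F s - F 0) /\<^sub>R s) ** matrix_inv (F 0))
      = (matrix_inv (F s) - matrix_inv (F 0)) /\<^sub>R s"
    using eventually_invertible[OF cont inv]
    by eventually_elim
       (simp add: matrix_inv_diff inv matrix_mult_scaleR_left matrix_mult_scaleR_right)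
  ultimately show ?thesis
    unfolding has_vector_derivative_at_0_iff by (rule Lim_transform_eventually)
qed

text \<open>
  The definition of \<open>partial\<close> picks some derivative along the coordinate line;
  differentiability makes it the actual one.
\<close>
lemma has_vector_derivative_partial:
  fixes F :: "real^'p \<Rightarrow> 'b::real_normed_vector"
  assumes "F differentiable (at \<eta>)"
  shows "((\<lambda>s. F (\<eta> + s *\<^sub>R axis k 1)) has_vector_derivative partial k F \<eta>) (at 0)"
proof -
  have "(\<lambda>s::real. \<eta> + s *\<^sub>R axis k 1) differentiable (at 0)"
    by (intro derivative_intros)
  then have "(F \<circ> (\<lambda>s. \<eta> + s *\<^sub>R axis k 1)) differentiable (at 0)"
    using assms by (intro differentiable_chain_at) auto
  then show ?thesis
    unfolding partial_def by (simp add: vector_derivative_works o_def)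
qed

lemma partial_eqI:
  assumes "((\<lambda>s. F (\<eta> + s *\<^sub>R axis k 1)) has_vector_derivative D) (at 0)"
  shows "partial k F \<eta> = D"
  unfolding partial_def using assms by (rule vector_derivative_at)

lemma partial_matrix_inv:
  fixes F :: "real^'p \<Rightarrow> real^'n^'n"
  assumes "F differentiable (at \<eta>)" "invertible (F \<eta>)"
  shows "partial k (\<lambda>x. matrix_inv (F x)) \<eta> =
           - (matrix_inv (F \<eta>) ** partial k F \<eta> ** matrix_inv (F \<eta>))"
  using has_vector_derivative_matrix_inv[OF has_vector_derivative_partial[OF assms(1), of k]] assms(2)
  by (intro partial_eqI) simp

text \<open>
  Differentiability of \<open>F\<close> at \<open>\<eta>\<close> alone would not describe
  \<open>partial l\<close> of the inverse at the neighbouring points at which it is differentiated again.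
  The formula of \<open>partial_matrix_inv\<close> is available on a whole neighbourhood, since
  \<open>F\<close> is differentiable and invertible there, and the product rule applies to it.
\<close>
lemma partial_partial_matrix_inv:
  fixes F :: "real^'p \<Rightarrow> real^'n^'n"
  assumes F: "twice_differentiable_at F \<eta>" and inv: "invertible (F \<eta>)"
  shows "partial k (partial l (\<lambda>x. matrix_inv (F x))) \<eta> =
           matrix_inv (F \<eta>) ** partial l F \<eta> ** matrix_inv (F \<eta>) ** partial k F \<eta> ** matrix_inv (F \<eta>)
         - matrix_inv (F \<eta>) ** partial k (partial l F) \<eta> ** matrix_inv (F \<eta>)
         + matrix_inv (F \<eta>) ** partial k F \<eta> ** matrix_inv (F \<eta>) ** partial l F \<eta> ** matrix_inv (F \<eta>)"
    (is "_ = ?D")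
proof -
  have diff: "\<forall>\<^sub>F x in nhds \<eta>. F differentiable (at x)"
    and diff2: "partial l F differentiable (at \<eta>)"
    using F by (auto simp: twice_differentiable_at_def)
  have F\<eta>: "F differentiable (at \<eta>)"
    using diff by (rule eventually_nhds_x_imp_x)
  have "(F \<longlongrightarrow> F \<eta>) (nhds \<eta>)"
    using differentiable_imp_continuous_within[OF F\<eta>] by (simp add: isCont_def tendsto_at_iff_tendsto_nhds)
  then have "\<forall>\<^sub>F x in nhds \<eta>. invertible (F x)"
    using inv by (rule eventually_invertible)
  with diff have "\<forall>\<^sub>F x in nhds \<eta>. partial l (\<lambda>x. matrix_inv (F x)) x =
      - (matrix_inv (F x) ** partial l F x ** matrix_inv (F x))"
    by eventually_elim (rule partial_matrix_inv)
  moreover have line: "((\<lambda>s::real. \<eta> + s *\<^sub>R axis k 1) \<longlongrightarrow> \<eta>) (nhds 0)"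
    by (rule tendsto_eq_intros filterlim_ident refl | simp)+
  ultimately have ev: "\<forall>\<^sub>F s in nhds (0::real).
      partial l (\<lambda>x. matrix_inv (F x)) (\<eta> + s *\<^sub>R axis k 1) =
      - (matrix_inv (F (\<eta> + s *\<^sub>R axis k 1)) ** partial l F (\<eta> + s *\<^sub>R axis k 1)
         ** matrix_inv (F (\<eta> + s *\<^sub>R axis k 1)))"
    by (rule eventually_compose_filterlim)
  let ?g = "\<lambda>s::real. \<eta> + s *\<^sub>R axis k 1"
  let ?A = "matrix_inv (F \<eta>)"
  have dI: "((\<lambda>s. matrix_inv (F (?g s))) has_vector_derivative - (?A ** partial k F \<eta> ** ?A)) (at 0)"
    using has_vector_derivative_matrix_inv[OF has_vector_derivative_partial[OF F\<eta>, of k]] inv by simp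
  have dP: "((\<lambda>s. partial l F (?g s)) has_vector_derivative partial k (partial l F) \<eta>) (at 0)"
    by (rule has_vector_derivative_partial[OF diff2])
  note mult = bounded_bilinear.has_vector_derivative[OF bounded_bilinear_matrix_mult]
  have "((\<lambda>s. - (matrix_inv (F (?g s)) ** partial l F (?g s) ** matrix_inv (F (?g s))))
      has_vector_derivative ?D) (at 0)"
    by (rule has_vector_derivative_eq_rhs[OF has_vector_derivative_minus[OF mult[OF mult[OF dI dP] dI]]])
       (simp add: matrix_mult_minus_left matrix_mult_minus_right matrix_mult_add_left
          matrix_mult_diff_left matrix_mul_assoc)
  then have "((\<lambda>s. partial l (\<lambda>x. matrix_inv (F x)) (?g s)) has_vector_derivative ?D) (at 0)"
    unfolding has_vector_derivative_def
    by (rule has_derivative_transform_eventually)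
       (use ev eventually_nhds_x_imp_x[OF ev] in \<open>auto simp: eventually_at_filter elim: eventually_mono\<close>)
  then show ?thesis by (rule partial_eqI)
qed

text \<open>
  The one-dimensional mean value theorem along the segment from \<open>x\<close> to \<open>y\<close>, with
  the directional derivative then expanded in coordinates.
\<close>
lemma mean_value_partial:
  fixes F :: "real^'p \<Rightarrow> real"
  assumes F: "\<And>z. z \<in> closed_segment x y \<Longrightarrow> F differentiable (at z)"
  obtains z where "z \<in> closed_segment x y"
    and "F y - F x = (\<Sum>k\<in>UNIV. partial k F z * (axis k 1 \<bullet> (y - x)))"
proof -
  let ?g = "\<lambda>s::real. x + s *\<^sub>R (y - x)"
  have seg: "?g s \<in> closed_segment x y" if "0 \<le> s" "s \<le> 1" for s
    using that by (auto simp: in_segment algebra_simps intro!: exI[of _ s])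
  have der: "((\<lambda>s. F (?g s)) has_real_derivative
      frechet_derivative F (at (?g s)) (y - x)) (at s)" if "0 \<le> s" "s \<le> 1" for s
  proof -
    let ?D = "frechet_derivative F (at (?g s))"
    have D: "(F has_derivative ?D) (at (?g s))"
      using F[OF seg[OF that]] by (simp add: frechet_derivative_works)
    then have "((F \<circ> ?g) has_derivative (?D \<circ> (\<lambda>h. h *\<^sub>R (y - x)))) (at s)"
      by (intro diff_chain_at) (auto intro!: derivative_eq_intros)
    moreover have "?D \<circ> (\<lambda>h. h *\<^sub>R (y - x)) = (*) (?D (y - x))"
      using has_derivative_linear[OF D] by (auto simp: linear_cmul)
    ultimately show ?thesis by (simp add: has_field_derivative_def o_def)
  qed
  obtain s where s: "0 < s" "s < 1"
    "F (?g 1) - F (?g 0) = (1 - 0) * frechet_derivative F (at (?g s)) (y - x)"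
    using MVT2[of 0 1 "\<lambda>s. F (?g s)" "\<lambda>s. frechet_derivative F (at (?g s)) (y - x)"] der
    by auto
  let ?z = "?g s" and ?D = "frechet_derivative F (at (?g s))"
  have D: "(F has_derivative ?D) (at ?z)"
    using F[OF seg] s by (simp add: frechet_derivative_works)
  then have lin: "linear ?D" by (rule has_derivative_linear)
  have "partial k F ?z = ?D (axis k 1)" for k
  proof (rule partial_eqI)
    have "((F \<circ> (\<lambda>h. ?z + h *\<^sub>R axis k 1)) has_derivative (?D \<circ> (\<lambda>h. h *\<^sub>R axis k 1))) (at 0)"
      by (intro diff_chain_at) (auto intro!: derivative_eq_intros simp: D)
    then show "((\<lambda>h. F (?z + h *\<^sub>R axis k 1)) has_vector_derivative ?D (axis k 1)) (at 0)"
      by (simp add: has_vector_derivative_def o_def linear_cmul[OF lin])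
  qed
  moreover have "?D (y - x) = (\<Sum>k\<in>UNIV. (y - x) $ k * ?D (axis k 1))"
  proof -
    have "?D (\<Sum>k\<in>UNIV. (y - x) $ k *\<^sub>R axis k 1) = (\<Sum>k\<in>UNIV. (y - x) $ k *\<^sub>R ?D (axis k 1))"
      by (simp add: linear_sum[OF lin] linear_cmul[OF lin] o_def)
    then show ?thesis
      using basis_expansion[of "y - x"] by (simp add: scalar_mult_eq_scaleR)
  qed
  ultimately have "F y - F x = (\<Sum>k\<in>UNIV. partial k F ?z * (axis k 1 \<bullet> (y - x)))"
    using s(3) by (simp add: inner_axis' mult.commute)
  then show ?thesis
    using that seg[of s] s by auto
qed

lemma partial_entry:
  fixes P :: "real^'p \<Rightarrow> real^'n^'m"
  assumes "P differentiable (at z)"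
  shows "(\<lambda>x. P x $ i $ j) differentiable (at z)"
    and "partial k (\<lambda>x. P x $ i $ j) z = partial k P z $ i $ j"
proof -
  have bl: "bounded_linear (\<lambda>A :: real^'n^'m. A $ i $ j)"
    using bounded_linear_compose[OF bounded_linear_vec_nth bounded_linear_vec_nth] .
  obtain D where "(P has_derivative D) (at z)"
    using assms by (auto simp: differentiable_def)
  from bounded_linear.has_derivative[OF bl this]
  show "(\<lambda>x. P x $ i $ j) differentiable (at z)"
    by (auto simp: differentiable_def)
  show "partial k (\<lambda>x. P x $ i $ j) z = partial k P z $ i $ j"
    using bounded_linear.has_vector_derivative[OF bl has_vector_derivative_partial[OF assms]]
    by (rule partial_eqI)
qed

text \<open>
  A vector-valued function need not have a single intermediate point at which the increment is attained, so
  each entry gets its own.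
\<close>
lemma mean_value_matrix:
  fixes P :: "real^'p \<Rightarrow> real^'n^'m"
  assumes diff: "\<And>z. z \<in> closed_segment x y \<Longrightarrow> P differentiable (at z)"
  obtains z where "\<And>i j. z i j \<in> closed_segment x y"
    and "P y - P x = (\<chi> i j. \<Sum>k\<in>UNIV. partial k P (z i j) $ i $ j * (axis k 1 \<bullet> (y - x)))"
proof -
  have "\<exists>z. z \<in> closed_segment x y \<and>
      P y $ i $ j - P x $ i $ j = (\<Sum>k\<in>UNIV. partial k P z $ i $ j * (axis k 1 \<bullet> (y - x)))" for i j
  proof -
    obtain z where z: "z \<in> closed_segment x y"
      "P y $ i $ j - P x $ i $ j = (\<Sum>k\<in>UNIV. partial k (\<lambda>x. P x $ i $ j) z * (axis k 1 \<bullet> (y - x)))"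
      using mean_value_partial[of x y "\<lambda>x. P x $ i $ j"] partial_entry(1)[OF diff] by blast
    then show ?thesis by (auto simp: partial_entry(2)[OF diff])
  qed
  then have "\<forall>i j. \<exists>z. z \<in> closed_segment x y \<and>
      P y $ i $ j - P x $ i $ j = (\<Sum>k\<in>UNIV. partial k P z $ i $ j * (axis k 1 \<bullet> (y - x)))"
    by blast
  then obtain z where z: "\<forall>i j. z i j \<in> closed_segment x y \<and>
      P y $ i $ j - P x $ i $ j = (\<Sum>k\<in>UNIV. partial k P (z i j) $ i $ j * (axis k 1 \<bullet> (y - x)))"
    unfolding choice_iff by blast
  show ?thesis
  proof (rule that)
    show "z i j \<in> closed_segment x y" for i j
      using z by blast
    show "P y - P x = (\<chi> i j. \<Sum>k\<in>UNIV. partial k P (z i j) $ i $ j * (axis k 1 \<bullet> (y - x)))"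
      using z by (simp add: vec_eq_iff)
  qed
qed

section \<open>Coercive and positive definite matrices\<close>

lemma invertible_if_kernel_trivial:
  fixes A :: "real^'n^'n"
  assumes "\<And>x. A *v x = 0 \<Longrightarrow> x = 0"
  shows "invertible A"
  using assms matrix_left_invertible_ker[of A] invertible_left_inverse[of A] by blast

text \<open>
  Coercivity with constant \<open>c\<close> bounds the operator norm of the inverse by
  \<open>1 / c\<close>. The norm on matrices here is the Frobenius norm, which is at most the sum of the
  absolute values of the \<open>n\<^sup>2\<close> entries; this crude comparison is the source of the
  factor.
\<close>
lemma norm_matrix_inv_le:
  fixes A :: "real^'n^'n"
  assumes c: "c > 0" and A: "\<And>x. c * (norm x)\<^sup>2 \<le> x \<bullet> (A *v x)"
  shows "norm (matrix_inv A) \<le> real (CARD('n)) * real (CARD('n)) / c"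
proof -
  have inv: "invertible A"
  proof (rule invertible_if_kernel_trivial)
    fix x assume "A *v x = 0"
    then have "c * (norm x)\<^sup>2 \<le> 0" using A[of x] by simp
    then show "x = 0" using c by (simp add: mult_le_0_iff)
  qed
  have col: "norm (matrix_inv A *v x) \<le> norm x / c" for x
  proof -
    let ?y = "matrix_inv A *v x"
    have "A *v ?y = x"
      by (simp add: matrix_vector_mul_assoc matrix_inv_mult[OF inv])
    then have "c * (norm ?y)\<^sup>2 \<le> ?y \<bullet> x" using A[of ?y] by simp
    also have "\<dots> \<le> norm ?y * norm x" by (rule norm_cauchy_schwarz)
    finally have "norm ?y * (c * norm ?y) \<le> norm ?y * norm x"
      by (simp add: power2_eq_square ac_simps)
    then have "?y = 0 \<or> c * norm ?y \<le> norm x"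
      using mult_le_cancel_left_pos[of "norm ?y"] by (cases "?y = 0") auto
    then show ?thesis using c by (auto simp: field_simps)
  qed
  have ent: "\<bar>matrix_inv A $ i $ j\<bar> \<le> 1 / c" for i j
  proof -
    have "matrix_inv A $ i $ j = (matrix_inv A *v axis j 1) $ i"
      by (simp add: matrix_vector_mul_component inner_axis)
    also have "\<bar>\<dots>\<bar> \<le> norm (matrix_inv A *v axis j 1)" by (rule component_le_norm_cart)
    also have "\<dots> \<le> 1 / c" using col[of "axis j 1"] by simp
    finally show ?thesis .
  qed
  have "norm (matrix_inv A) \<le> (\<Sum>i\<in>UNIV. norm (matrix_inv A $ i))"
    unfolding norm_vec_def[of "matrix_inv A"] by (rule L2_set_le_sum) simp
  also have "\<dots> \<le> (\<Sum>i\<in>(UNIV::'n set). \<Sum>j\<in>(UNIV::'n set). \<bar>matrix_inv A $ i $ j\<bar>)"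
    by (intro sum_mono norm_le_l1_cart)
  also have "\<dots> \<le> (\<Sum>i\<in>(UNIV::'n set). \<Sum>j\<in>(UNIV::'n set). 1 / c)"
    by (intro sum_mono ent)
  finally show ?thesis by simp
qed

text \<open>
  Entrywise convergence of matrices is turned into a lower bound on quadratic forms that is uniform in the
  direction \<open>x\<close>.
\<close>
lemma quadform_ge_of_close:
  fixes A B :: "real^'n^'n"
  assumes "\<And>i j. \<bar>A $ i $ j - B $ i $ j\<bar> \<le> \<epsilon>"
  shows "x \<bullet> (B *v x) - \<epsilon> * (real CARD('n))\<^sup>2 * (norm x)\<^sup>2 \<le> x \<bullet> (A *v x)"
proof -
  have "x \<bullet> (B *v x) - x \<bullet> (A *v x) = (\<Sum>i\<in>UNIV. \<Sum>j\<in>UNIV. x $ i * ((B $ i $ j - A $ i $ j) * x $ j))"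
    by (simp add: inner_vec_def matrix_vector_mult_def sum_distrib_left algebra_simps sum_subtractf)
  also have "\<dots> \<le> (\<Sum>i\<in>(UNIV::'n set). \<Sum>j\<in>(UNIV::'n set). \<epsilon> * (norm x)\<^sup>2)"
  proof (intro sum_mono)
    fix i j
    have "x $ i * ((B $ i $ j - A $ i $ j) * x $ j) \<le> \<bar>x $ i\<bar> * (\<bar>A $ i $ j - B $ i $ j\<bar> * \<bar>x $ j\<bar>)"
      by (metis abs_ge_self abs_minus_commute abs_mult)
    also have "\<dots> \<le> norm x * (\<epsilon> * norm x)"
      using order_trans[OF abs_ge_zero assms[of i j]]
      by (intro mult_mono assms component_le_norm_cart) auto
    finally show "x $ i * ((B $ i $ j - A $ i $ j) * x $ j) \<le> \<epsilon> * (norm x)\<^sup>2"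
      by (simp add: power2_eq_square ac_simps)
  qed
  also have "\<dots> = \<epsilon> * (real CARD('n))\<^sup>2 * (norm x)\<^sup>2"
    by (simp add: power2_eq_square)
  finally show ?thesis by linarith
qed

text \<open>
  The constant is the minimum of the quadratic form on the unit sphere, which is attained by compactness.
\<close>
lemma pos_def_coercive:
  fixes A :: "real^'n^'n"
  assumes "pos_def A"
  obtains c where "c > 0" "\<And>x. c * (norm x)\<^sup>2 \<le> x \<bullet> (A *v x)"
proof -
  let ?q = "\<lambda>x. x \<bullet> (A *v x)"
  have "continuous_on (sphere 0 1) ?q"
    by (intro continuous_intros linear_continuous_on matrix_vector_mul_bounded_linear)
  moreover have "sphere (0::real^'n) 1 \<noteq> {}" by simp
  ultimately obtain z where z: "z \<in> sphere 0 1" "\<And>x. x \<in> sphere 0 1 \<Longrightarrow> ?q z \<le> ?q x"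
    using continuous_attains_inf[of "sphere (0::real^'n) 1" ?q] by auto
  show thesis
  proof
    have "z \<noteq> 0" using z(1) by auto
    then show "?q z > 0" using assms by (auto simp: pos_def_def)
    fix x :: "real^'n"
    show "?q z * (norm x)\<^sup>2 \<le> ?q x"
    proof (cases "x = 0")
      case False
      have "?q z \<le> ?q (x /\<^sub>R norm x)" using False by (intro z(2)) simp
      also have "\<dots> = ?q x / (norm x)\<^sup>2"
        by (simp add: matrix_vector_mult_scaleR power2_eq_square field_simps)
      finally show ?thesis using False by (simp add: field_simps)
    qed simp
  qed
qed

section \<open>The Gram matrix, the least squares residual and the regularized matrix\<close>

lemma quadform_gram:
  "x \<bullet> (gram idx u N \<omega> *v x) = (\<Sum>t=1..N. (regressor idx u t \<omega> \<bullet> x)\<^sup>2)"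
proof -
  have "(\<Sum>t=1..N. (regressor idx u t \<omega> \<bullet> x)\<^sup>2)
      = (\<Sum>t=1..N. \<Sum>i\<in>UNIV. \<Sum>j\<in>UNIV.
          x $ i * (regressor idx u t \<omega> $ i * regressor idx u t \<omega> $ j * x $ j))"
    by (simp add: inner_vec_def power2_eq_square sum_product ac_simps)
  also have "\<dots> = (\<Sum>i\<in>UNIV. \<Sum>j\<in>UNIV. \<Sum>t=1..N.
          x $ i * (regressor idx u t \<omega> $ i * regressor idx u t \<omega> $ j * x $ j))"
    by (subst sum.swap, intro sum.cong refl, subst sum.swap, rule refl)
  also have "\<dots> = x \<bullet> (gram idx u N \<omega> *v x)"
    by (simp add: inner_vec_def matrix_vector_mult_def gram_def sum_distrib_left sum_distrib_right)
  finally show ?thesis by simp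
qed

lemma quadform_gram_mono:
  "N \<le> N' \<Longrightarrow> x \<bullet> (gram idx u N \<omega> *v x) \<le> x \<bullet> (gram idx u N' \<omega> *v x)"
  unfolding quadform_gram by (rule sum_mono2) auto

text \<open>
  If the form vanishes at \<open>x\<close>, then \<open>x\<close> is orthogonal to all regressors, and
  these span the space.
\<close>
lemma quadform_gram_pos:
  assumes "full_column_rank idx u N \<omega>" "x \<noteq> 0"
  shows "0 < x \<bullet> (gram idx u N \<omega> *v x)"
proof (rule ccontr)
  let ?R = "(\<lambda>t. regressor idx u t \<omega>) ` {1..N}"
  assume "\<not> ?thesis"
  then have "(\<Sum>t=1..N. (regressor idx u t \<omega> \<bullet> x)\<^sup>2) = 0"
    unfolding quadform_gram using sum_nonneg[of "{1..N}" "\<lambda>t. (regressor idx u t \<omega> \<bullet> x)\<^sup>2"] by fastforce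
  then have "\<forall>t\<in>{1..N}. regressor idx u t \<omega> \<bullet> x = 0"
    by (simp add: sum_nonneg_eq_0_iff)
  then have orth: "orthogonal x r" if "r \<in> ?R" for r
    using that by (auto simp: orthogonal_def inner_commute)
  have "dim ?R = DIM(real^'a)"
    using assms(1) by (simp add: full_column_rank_def)
  then have "span ?R = UNIV"
    by (simp only: dim_eq_full)
  then have "orthogonal x x"
    using orthogonal_to_span[of x ?R x] orth by blast
  with assms(2) show False by (simp add: orthogonal_def)
qed

lemma invertible_gram:
  assumes "full_column_rank idx u N \<omega>"
  shows "invertible (gram idx u N \<omega>)"
  using quadform_gram_pos[OF assms] by (intro invertible_if_kernel_trivial) force

lemma quadform_inv_gram_pos:
  assumes "full_column_rank idx u N \<omega>" "x \<noteq> 0"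
  shows "0 < x \<bullet> (matrix_inv (gram idx u N \<omega>) *v x)"
proof -
  let ?G = "gram idx u N \<omega>" and ?y = "matrix_inv (gram idx u N \<omega>) *v x"
  have x: "?G *v ?y = x"
    by (simp add: matrix_vector_mul_assoc matrix_inv_mult[OF invertible_gram[OF assms(1)]])
  then have "?y \<noteq> 0" using assms(2) by auto
  from quadform_gram_pos[OF assms(1) this] show ?thesis
    by (simp add: x inner_commute)
qed

lemma noise_var_estimate_nonneg: "N > CARD('n) \<Longrightarrow> 0 \<le> noise_var_estimate (idx :: 'n::finite \<Rightarrow> nat) u y N \<omega>"
  unfolding noise_var_estimate_def by (intro divide_nonneg_nonneg sum_nonneg) auto

text \<open>
  If the estimated noise variance is positive, the second summand makes the matrix positive definite.
  Otherwise the matrix is \<open>P \<eta>\<close> itself.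
\<close>
lemma invertible_S_hat:
  fixes idx :: "'n::finite \<Rightarrow> nat"
  assumes N: "N > CARD('n)" and rank: "full_column_rank idx u N \<omega>"
    and psd: "\<And>x. 0 \<le> x \<bullet> (P \<eta> *v x)" and inv: "invertible (P \<eta>)"
  shows "invertible (S_hat P idx u y N \<omega> \<eta>)"
proof (cases "noise_var_estimate idx u y N \<omega> = 0")
  case True
  then show ?thesis using inv by (simp add: S_hat_def)
next
  case False
  then have pos: "noise_var_estimate idx u y N \<omega> > 0"
    using noise_var_estimate_nonneg[OF N, of idx u y \<omega>] by simp
  show ?thesis
  proof (rule invertible_if_kernel_trivial, rule ccontr)
    fix x assume x: "S_hat P idx u y N \<omega> \<eta> *v x = 0" "x \<noteq> 0"
    have "0 < x \<bullet> (P \<eta> *v x) + noise_var_estimate idx u y N \<omega> * (x \<bullet> (matrix_inv (gram idx u N \<omega>) *v x))"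
      using psd[of x] pos quadform_inv_gram_pos[OF rank x(2)] by (intro add_nonneg_pos) auto
    also have "\<dots> = x \<bullet> (S_hat P idx u y N \<omega> \<eta> *v x)"
      by (simp add: S_hat_def matrix_vector_mult_add_rdistrib scaleR_matrix_vector_assoc[symmetric]
          inner_add_right)
    finally show False using x by simp
  qed
qed

text \<open>
  The residual at the estimate is orthogonal to all columns of the regression matrix (normal equations), so
  by Pythagoras the residual sum of squares at the true parameter, which is the noise energy, exceeds the
  minimal one by \<open>\<Sum>t. (\<phi>(t) \<bullet> d)\<^sup>2\<close>, where \<open>d\<close> is the
  estimation error.
\<close>
lemma noise_var_estimate_le:
  fixes idx :: "'n::finite \<Rightarrow> nat" and \<theta>\<^sub>0 :: "real^'n"
  assumes N: "N > CARD('n)" and rank: "full_column_rank idx u N \<omega>"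
    and model: "\<And>t. t \<ge> 1 \<Longrightarrow> y t \<omega> = regressor idx u t \<omega> \<bullet> \<theta>\<^sub>0 + v t \<omega>"
  shows "noise_var_estimate idx u y N \<omega> \<le> (\<Sum>t=1..N. (v t \<omega>)\<^sup>2) / (real N - real CARD('n))"
proof -
  let ?G = "gram idx u N \<omega>" and ?\<phi> = "\<lambda>t. regressor idx u t \<omega>"
  define \<theta>h where "\<theta>h = ls_estimate idx u y N \<omega>"
  define d where "d = \<theta>h - \<theta>\<^sub>0"
  let ?r = "\<lambda>t. y t \<omega> - ?\<phi> t \<bullet> \<theta>h"
  have "?G *v \<theta>h = (\<Sum>t=1..N. y t \<omega> *\<^sub>R ?\<phi> t)"
    by (simp add: \<theta>h_def ls_estimate_def matrix_vector_mul_assoc matrix_inv_mult[OF invertible_gram[OF rank]])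
  moreover have "?G *v \<theta>h = (\<Sum>t=1..N. (?\<phi> t \<bullet> \<theta>h) *\<^sub>R ?\<phi> t)"
  proof -
    have "(?G *v \<theta>h) $ i = (\<Sum>t=1..N. (?\<phi> t \<bullet> \<theta>h) *\<^sub>R ?\<phi> t) $ i" for i
    proof -
      have "(?G *v \<theta>h) $ i = (\<Sum>j\<in>UNIV. \<Sum>t=1..N. ?\<phi> t $ i * ?\<phi> t $ j * \<theta>h $ j)"
        by (simp add: matrix_vector_mult_def gram_def sum_distrib_right)
      also have "\<dots> = (\<Sum>t=1..N. \<Sum>j\<in>UNIV. ?\<phi> t $ i * ?\<phi> t $ j * \<theta>h $ j)"
        by (rule sum.swap)
      also have "\<dots> = (\<Sum>t=1..N. (?\<phi> t \<bullet> \<theta>h) *\<^sub>R ?\<phi> t) $ i"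
        by (simp add: inner_vec_def sum_distrib_left sum_distrib_right ac_simps)
      finally show ?thesis .
    qed
    then show ?thesis by (simp add: vec_eq_iff)
  qed
  ultimately have normal: "(\<Sum>t=1..N. ?r t *\<^sub>R ?\<phi> t) = 0"
    by (simp add: scaleR_diff_left sum_subtractf)
  have "(\<Sum>t=1..N. ?r t * (?\<phi> t \<bullet> d)) = (\<Sum>t=1..N. ?r t *\<^sub>R ?\<phi> t) \<bullet> d"
    by (simp add: inner_sum_left)
  then have cross: "(\<Sum>t=1..N. ?r t * (?\<phi> t \<bullet> d)) = 0"
    unfolding normal by simp
  have "(\<Sum>t=1..N. (v t \<omega>)\<^sup>2) = (\<Sum>t=1..N. (?r t)\<^sup>2 + (?\<phi> t \<bullet> d)\<^sup>2 + 2 * (?r t * (?\<phi> t \<bullet> d)))"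
  proof (intro sum.cong refl)
    fix t assume "t \<in> {1..N}"
    then have "v t \<omega> = ?r t + ?\<phi> t \<bullet> d"
      using model[of t] by (simp add: d_def inner_diff_right)
    then show "(v t \<omega>)\<^sup>2 = (?r t)\<^sup>2 + (?\<phi> t \<bullet> d)\<^sup>2 + 2 * (?r t * (?\<phi> t \<bullet> d))"
      by (simp only: power2_sum mult.assoc)
  qed
  also have "\<dots> = (\<Sum>t=1..N. (?r t)\<^sup>2) + (\<Sum>t=1..N. (?\<phi> t \<bullet> d)\<^sup>2)"
    by (simp add: sum.distrib sum_distrib_left[symmetric] cross[simplified])
  finally have "(\<Sum>t=1..N. (?r t)\<^sup>2) \<le> (\<Sum>t=1..N. (v t \<omega>)\<^sup>2)"
    by (simp add: sum_nonneg)
  then show ?thesis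
    unfolding noise_var_estimate_def \<theta>h_def using N by (intro divide_right_mono) auto
qed

text \<open>
  The comparison matrix \<open>A\<close> is left free: it is the value of \<open>P\<close> at the same
  hyper-parameter in one application, and its value at the limit in another.
\<close>
lemma S_hat_inv_diff:
  fixes idx :: "'n::finite \<Rightarrow> nat"
  assumes S: "invertible (S_hat P idx u y N \<omega> \<eta>)" and A: "invertible A"
  shows "matrix_inv (S_hat P idx u y N \<omega> \<eta>) - matrix_inv A =
      - (matrix_inv (S_hat P idx u y N \<omega> \<eta>) ** (P \<eta> - A) ** matrix_inv A)
      - noise_var_estimate idx u y N \<omega> *\<^sub>R
          (matrix_inv (S_hat P idx u y N \<omega> \<eta>) ** matrix_inv (gram idx u N \<omega>) ** matrix_inv A)"
proof -
  let ?G = "matrix_inv (gram idx u N \<omega>)" and ?s = "noise_var_estimate idx u y N \<omega>"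
  have d: "S_hat P idx u y N \<omega> \<eta> - A = (P \<eta> - A) + ?s *\<^sub>R ?G"
    by (simp add: S_hat_def)
  show ?thesis
    unfolding matrix_inv_diff[OF S A] d
    by (simp add: matrix_mult_add_left matrix_mult_add_right matrix_mult_scaleR_left matrix_mult_scaleR_right)
qed

lemma partial_add_const: "partial k (\<lambda>x. F x + C) = partial k F"
  by (simp add: fun_eq_iff partial_def vector_derivative_def has_vector_derivative_add_const)

lemma partial_S_hat: "partial k (S_hat P idx u y N \<omega>) = partial k P"
  unfolding S_hat_def[abs_def] by (rule partial_add_const)

lemma differentiable_S_hat:
  "P differentiable F \<Longrightarrow> S_hat P idx u y N \<omega> differentiable F"
  unfolding S_hat_def[abs_def] by (intro differentiable_add differentiable_const)

lemma twice_differentiable_S_hat: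
  assumes "twice_differentiable_at P \<eta>"
  shows "twice_differentiable_at (S_hat P idx u y N \<omega>) \<eta>"
  using assms unfolding twice_differentiable_at_def partial_S_hat
  by (auto elim: eventually_mono intro: differentiable_S_hat)

lemma kernel_matrix_quadform_nonneg:
  fixes idx :: "'n::finite \<Rightarrow> nat"
  assumes idx: "bij_betw idx UNIV {1..CARD('n)}" and K: "psd_kernel_on {1..} K"
  shows "0 \<le> x \<bullet> ((\<chi> i j. K (idx i) (idx j)) *v x)"
proof -
  define c where "c m = x $ (inv_into UNIV idx m)" for m
  have c: "c (idx i) = x $ i" for i
    using idx by (simp add: c_def bij_betw_def)
  have "0 \<le> (\<Sum>i\<in>{1..CARD('n)}. \<Sum>j\<in>{1..CARD('n)}. c i * c j * K i j)"
    using K[unfolded psd_kernel_on_def, THEN conjunct2, rule_format, of "{1..CARD('n)}" c]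
    by (simp add: subset_iff)
  also have "\<dots> = (\<Sum>i\<in>UNIV. \<Sum>j\<in>UNIV. x $ i * x $ j * K (idx i) (idx j))"
    by (simp only: sum.reindex_bij_betw[OF idx, symmetric] c)
  also have "\<dots> = x \<bullet> ((\<chi> i j. K (idx i) (idx j)) *v x)"
    by (simp add: inner_vec_def matrix_vector_mult_def sum_distrib_left ac_simps)
  finally show ?thesis .
qed

section \<open>Almost sure convergence from moment bounds\<close>

text \<open>
  The first Borel-Cantelli argument in expectation form: the series has finite expectation by monotone
  convergence, hence is finite almost surely. In particular its terms tend to 0.
\<close>
lemma AE_summable_of_expectations:
  fixes X :: "nat \<Rightarrow> 'a \<Rightarrow> real"
  assumes meas: "\<And>k. X k \<in> borel_measurable M"
    and nonneg: "\<And>k \<omega>. 0 \<le> X k \<omega>"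
    and le: "\<And>k. (\<integral>\<^sup>+\<omega>. ennreal (X k \<omega>) \<partial>M) \<le> ennreal (b k)"
    and b: "summable b" "\<And>k. 0 \<le> b k"
  shows "AE \<omega> in M. summable (\<lambda>k. X k \<omega>)"
proof -
  have "(\<integral>\<^sup>+\<omega>. (\<Sum>k. ennreal (X k \<omega>)) \<partial>M) = (\<Sum>k. \<integral>\<^sup>+\<omega>. ennreal (X k \<omega>) \<partial>M)"
    using meas by (intro nn_integral_suminf) auto
  also have "\<dots> \<le> (\<Sum>k. ennreal (b k))"
    by (intro suminf_le le) auto
  also have "\<dots> < \<infinity>"
    using ennreal_suminf_neq_top[OF b] by (simp add: less_top)
  finally have "(\<integral>\<^sup>+\<omega>. (\<Sum>k. ennreal (X k \<omega>)) \<partial>M) \<noteq> \<infinity>"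
    by simp
  then have "AE \<omega> in M. (\<Sum>k. ennreal (X k \<omega>)) \<noteq> \<infinity>"
    using meas by (intro nn_integral_PInf_AE) auto
  then show ?thesis
    by eventually_elim (intro summable_suminf_not_top nonneg, simp)
qed

text \<open>
  Kronecker's lemma for nonnegative terms and the weights \<open>t\<^bsup>q\<^esup>\<close>. With
  nonnegative terms it is an instance of dominated convergence for series:
  \<open>a t / N\<^bsup>q\<^esup>\<close>, cut off at \<open>t = N\<close>, is dominated by
  \<open>a t / t\<^bsup>q\<^esup>\<close> and tends to 0 for each \<open>t\<close>.
\<close>
lemma kronecker_powr:
  fixes a :: "nat \<Rightarrow> real"
  assumes nonneg: "\<And>t. 0 \<le> a t" and q: "q > 0" and summable: "summable (\<lambda>t. a t / real t powr q)"
  shows "(\<lambda>N. (\<Sum>t=1..N. a t) / real N powr q) \<longlonglongrightarrow> 0"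
proof -
  define f where "f t N = (if t \<in> {1..N} then a t / real N powr q else 0)" for t N
  have "(\<lambda>N. f t N) \<longlonglongrightarrow> 0" for t
  proof (rule tendsto_sandwich[of "\<lambda>_. 0" _ _ "\<lambda>N. a t / real N powr q"])
    have "(\<lambda>N. real N powr (- q)) \<longlonglongrightarrow> 0"
      using q by (intro tendsto_neg_powr filterlim_real_sequentially) auto
    from tendsto_mult_right_zero[OF this, of "a t"]
    show "(\<lambda>N. a t / real N powr q) \<longlonglongrightarrow> 0"
      by (simp add: powr_minus_divide)
  qed (auto simp: f_def nonneg)
  moreover have "norm (f t N) \<le> a t / real t powr q" for t N
    using nonneg[of t] q
    by (auto simp: f_def intro!: divide_left_mono powr_mono2 mult_pos_pos)
  then have "\<forall>\<^sub>F (t, N) in at_top \<times>\<^sub>F sequentially. norm (f t N) \<le> a t / real t powr q"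
    by (intro always_eventually) auto
  ultimately have "(\<lambda>N. \<Sum>t. f t N) \<longlonglongrightarrow> (\<Sum>t. 0)"
    using tannerys_theorem[of f "\<lambda>_. 0" sequentially "\<lambda>t. a t / real t powr q"] summable by auto
  moreover have "(\<Sum>t. f t N) = (\<Sum>t=1..N. a t) / real N powr q" for N
    by (subst suminf_finite[of "{1..N}"]) (auto simp: f_def sum_divide_distrib)
  ultimately show ?thesis by simp
qed

text \<open>
  For \<open>q > 1\<close> the series \<open>\<Sum>t. v(t)\<^sup>2 / t\<^bsup>q\<^esup>\<close> has
  finite expectation, so \<open>kronecker_powr\<close> applies almost surely. With \<open>q = 3/2\<close>
  this controls the noise energy to the accuracy required.
\<close>
lemma AE_sum_squares_negligible:
  fixes v :: "nat \<Rightarrow> 'a \<Rightarrow> real"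
  assumes meas: "\<And>t. t \<ge> 1 \<Longrightarrow> v t \<in> borel_measurable M"
    and le: "\<And>t. t \<ge> 1 \<Longrightarrow> (\<integral>\<^sup>+\<omega>. ennreal ((v t \<omega>)\<^sup>2) \<partial>M) \<le> ennreal C"
    and q: "q > 1" and C: "C \<ge> 0"
  shows "AE \<omega> in M. (\<lambda>N. (\<Sum>t=1..N. (v t \<omega>)\<^sup>2) / real N powr q) \<longlonglongrightarrow> 0"
proof -
  have "AE \<omega> in M. summable (\<lambda>t. (v t \<omega>)\<^sup>2 / real t powr q)"
  proof (rule AE_summable_of_expectations)
    show "(\<lambda>\<omega>. (v t \<omega>)\<^sup>2 / real t powr q) \<in> borel_measurable M" for t
      using meas[of t] by (cases "t = 0") (auto simp: Suc_le_eq)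
    show "(\<integral>\<^sup>+\<omega>. ennreal ((v t \<omega>)\<^sup>2 / real t powr q) \<partial>M) \<le> ennreal (C * (1 / real t powr q))" for t
    proof (cases "t = 0")
      case False
      then have t: "t \<ge> 1" by simp
      have "(\<integral>\<^sup>+\<omega>. ennreal ((v t \<omega>)\<^sup>2 / real t powr q) \<partial>M)
          = (\<integral>\<^sup>+\<omega>. ennreal (1 / real t powr q) * ennreal ((v t \<omega>)\<^sup>2) \<partial>M)"
        by (simp add: ennreal_mult'[symmetric])
      also have "\<dots> = ennreal (1 / real t powr q) * (\<integral>\<^sup>+\<omega>. ennreal ((v t \<omega>)\<^sup>2) \<partial>M)"
        using meas[OF t] by (intro nn_integral_cmult) auto
      also have "\<dots> \<le> ennreal (1 / real t powr q) * ennreal C"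
        by (intro mult_left_mono le t) auto
      also have "\<dots> = ennreal (C * (1 / real t powr q))"
        using C by (subst ennreal_mult'[symmetric]) (auto simp: ac_simps)
      finally show ?thesis .
    qed simp
    show "summable (\<lambda>t. C * (1 / real t powr q))"
      using summable_real_powr_iff[of "- q"] q by (intro summable_mult) (simp add: powr_minus_divide)
  qed (use C in auto)
  then show ?thesis
    by eventually_elim (rule kronecker_powr; use q in auto)
qed

text \<open>
  By \<open>\<bar>x\<bar>\<^bsup>p\<^esup> \<le> 1 + \<bar>x\<bar>\<^bsup>q\<^esup>\<close>.
\<close>
lemma integrable_power_of_bounded_moments:
  fixes X :: "'i \<Rightarrow> 'a \<Rightarrow> real"
  assumes "prob_space M" and q: "bounded_moments M X I q" and p: "real p \<le> q"
    and i: "i \<in> I" and [measurable]: "X i \<in> borel_measurable M"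
  shows "integrable M (\<lambda>\<omega>. X i \<omega> ^ p)"
proof (rule Bochner_Integration.integrable_bound)
  interpret prob_space M by fact
  show "integrable M (\<lambda>\<omega>. 1 + \<bar>X i \<omega>\<bar> powr q)"
    using q i by (auto simp: bounded_moments_def)
  show "AE \<omega> in M. norm (X i \<omega> ^ p) \<le> norm (1 + \<bar>X i \<omega>\<bar> powr q)"
  proof (rule AE_I2)
    fix \<omega>
    show "norm (X i \<omega> ^ p) \<le> norm (1 + \<bar>X i \<omega>\<bar> powr q)"
    proof (cases "\<bar>X i \<omega>\<bar> \<le> 1")
      case True
      then have "\<bar>X i \<omega>\<bar> ^ p \<le> 1" by (intro power_le_one) auto
      then show ?thesis by (simp add: power_abs add_increasing2)
    next
      case False
      then have "\<bar>X i \<omega>\<bar> ^ p = \<bar>X i \<omega>\<bar> powr real p" by (simp add: powr_realpow)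
      also have "\<dots> \<le> \<bar>X i \<omega>\<bar> powr q" using False p by (intro powr_mono) auto
      finally show ?thesis by (simp add: power_abs)
    qed
  qed
qed auto

section \<open>Fourth-order white noise\<close>

text \<open>
  A single bound that gives integrability of all products of up to four noise variables: shorter products
  are padded with factors 1.
\<close>
lemma abs_mult4_le: "\<bar>a * b * (c * d)\<bar> \<le> a ^ 4 + b ^ 4 + c ^ 4 + (d ^ 4 :: real)"
proof -
  have *: "\<bar>x * y\<bar> \<le> (x\<^sup>2 + y\<^sup>2) / 2" for x y :: real
    using sum_squares_bound[of "\<bar>x\<bar>" "\<bar>y\<bar>"] by (simp add: abs_mult)
  have "\<bar>a * b * (c * d)\<bar> \<le> ((a * b)\<^sup>2 + (c * d)\<^sup>2) / 2" by (rule *)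
  moreover have sq: "(x * y)\<^sup>2 \<le> (x ^ 4 + y ^ 4) / 2" for x y :: real
    using *[of "x\<^sup>2" "y\<^sup>2"] by (simp add: power_mult_distrib abs_mult)
  moreover from sq[of a b] sq[of c d] have "((a * b)\<^sup>2 + (c * d)\<^sup>2) / 2 \<le> (a^4 + b^4 + c^4 + d^4) / 4"
    by simp
  moreover have "(a^4 + b^4 + c^4 + d^4) / 4 \<le> a^4 + b^4 + c^4 + d^4"
  proof -
    have "0 \<le> a^4 + b^4 + c^4 + d^4" by simp
    then show ?thesis by simp
  qed
  ultimately show ?thesis by (meson order_trans)
qed

lemma summable_mult_of_summable_abs:
  fixes a b :: "nat \<Rightarrow> real"
  assumes a: "summable (\<lambda>k. \<bar>a k\<bar>)" and b: "summable (\<lambda>k. \<bar>b k\<bar>)"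
  shows "summable (\<lambda>k. a k * b k)"
proof (rule summable_comparison_test')
  show "summable (\<lambda>k. (\<Sum>k. \<bar>a k\<bar>) * \<bar>b k\<bar>)"
    by (intro summable_mult b)
  show "norm (a k * b k) \<le> (\<Sum>k. \<bar>a k\<bar>) * \<bar>b k\<bar>" if "k \<ge> 0" for k
    using sum_le_suminf[OF a, of "{k}"] by (simp add: abs_mult mult_right_mono)
qed

text \<open>
  The Cauchy-Schwarz inequality with the weights \<open>\<bar>c i\<bar>\<close>. It replaces Minkowski's
  inequality in \<open>L\<^sup>2\<close>: a bound on the second moments of all \<open>y i\<close> passes
  to weighted sums at the price of the squared total weight.
\<close>
lemma square_weighted_sum_le:
  fixes c y :: "'i \<Rightarrow> real"
  shows "(\<Sum>i\<in>I. c i * y i)\<^sup>2 \<le> (\<Sum>i\<in>I. \<bar>c i\<bar>) * (\<Sum>i\<in>I. \<bar>c i\<bar> * (y i)\<^sup>2)"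
proof -
  have "(\<Sum>i\<in>I. c i * y i)\<^sup>2 \<le> (\<Sum>i\<in>I. \<bar>c i * y i\<bar>)\<^sup>2"
    by (rule abs_le_square_iff[THEN iffD1]) (simp add: sum_abs)
  also have "\<dots> = (\<Sum>i\<in>I. sqrt \<bar>c i\<bar> * (sqrt \<bar>c i\<bar> * \<bar>y i\<bar>))\<^sup>2"
    by (simp add: abs_mult mult.assoc[symmetric])
  also have "\<dots> \<le> (\<Sum>i\<in>I. (sqrt \<bar>c i\<bar>)\<^sup>2) * (\<Sum>i\<in>I. (sqrt \<bar>c i\<bar> * \<bar>y i\<bar>)\<^sup>2)"
    by (rule Cauchy_Schwarz_ineq_sum)
  finally show ?thesis by (simp add: power_mult_distrib)
qed

lemma sum_minus_const: "(\<Sum>t\<in>T. f t) - real (card T) * r = (\<Sum>t\<in>T. f t - r)"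
  by (simp add: sum_subtractf)

text \<open>
  Independent centred variables with common second moment \<open>s2\<close> and common fourth moment
  \<open>m4\<close>. The time index runs over all integers because a linear process reaches back into the
  infinite past.
\<close>
locale white_noise = prob_space M for M :: "'a measure" +
  fixes e :: "int \<Rightarrow> 'a \<Rightarrow> real" and s2 m4 :: real
  assumes indep: "indep_vars (\<lambda>_. borel) e UNIV"
    and fourth_integrable: "integrable M (\<lambda>\<omega>. e t \<omega> ^ 4)"
    and mean: "expectation (e t) = 0"
    and second: "expectation (\<lambda>\<omega>. (e t \<omega>)\<^sup>2) = s2"
    and fourth: "expectation (\<lambda>\<omega>. e t \<omega> ^ 4) = m4"
begin

lemma measurable_e [measurable]: "e t \<in> borel_measurable M"
  using indep by (simp add: indep_vars_def)

lemma integrable_e4: "integrable M (\<lambda>\<omega>. e p \<omega> * e q \<omega> * (e r \<omega> * e s \<omega>))"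
proof (rule Bochner_Integration.integrable_bound)
  show "integrable M (\<lambda>\<omega>. e p \<omega> ^ 4 + e q \<omega> ^ 4 + e r \<omega> ^ 4 + e s \<omega> ^ 4)"
    by (intro Bochner_Integration.integrable_add fourth_integrable)
qed (auto intro!: AE_I2 order_trans[OF abs_mult4_le])

lemma integrable_e3: "integrable M (\<lambda>\<omega>. e p \<omega> * e q \<omega> * e r \<omega>)"
proof (rule Bochner_Integration.integrable_bound)
  show "integrable M (\<lambda>\<omega>. e p \<omega> ^ 4 + e q \<omega> ^ 4 + e r \<omega> ^ 4 + 1 ^ 4)"
    by (intro Bochner_Integration.integrable_add fourth_integrable integrable_const)
  show "AE \<omega> in M. norm (e p \<omega> * e q \<omega> * e r \<omega>) \<le> norm (e p \<omega> ^ 4 + e q \<omega> ^ 4 + e r \<omega> ^ 4 + 1 ^ 4)"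
    using abs_mult4_le[of "e p _" "e q _" "e r _" 1] by (intro AE_I2) auto
qed auto

lemma integrable_e2: "integrable M (\<lambda>\<omega>. e p \<omega> * e q \<omega>)"
proof (rule Bochner_Integration.integrable_bound)
  show "integrable M (\<lambda>\<omega>. e p \<omega> ^ 4 + e q \<omega> ^ 4 + 1 ^ 4 + 1 ^ 4)"
    by (intro Bochner_Integration.integrable_add fourth_integrable integrable_const)
  show "AE \<omega> in M. norm (e p \<omega> * e q \<omega>) \<le> norm (e p \<omega> ^ 4 + e q \<omega> ^ 4 + 1 ^ 4 + 1 ^ 4)"
    using abs_mult4_le[of "e p _" "e q _" 1 1] by (intro AE_I2) auto
qed auto

lemma integrable_e1: "integrable M (e p)"
proof (rule Bochner_Integration.integrable_bound)
  show "integrable M (\<lambda>\<omega>. e p \<omega> ^ 4 + 1 ^ 4 + 1 ^ 4 + 1 ^ 4)"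
    by (intro Bochner_Integration.integrable_add fourth_integrable integrable_const)
  show "AE \<omega> in M. norm (e p \<omega>) \<le> norm (e p \<omega> ^ 4 + 1 ^ 4 + 1 ^ 4 + 1 ^ 4)"
    using abs_mult4_le[of "e p _" 1 1 1] by (intro AE_I2) auto
qed auto

text \<open>
  The indices \<open>q\<close>, \<open>r\<close>, \<open>s\<close> may coincide; only \<open>p\<close> has
  to differ from them.
\<close>
lemma expectation_isolated_factor:
  assumes "p \<notin> {q, r, s}"
  shows "expectation (\<lambda>\<omega>. e p \<omega> * (e q \<omega> * e r \<omega> * e s \<omega>)) = 0"
proof -
  let ?B = "{q, r, s}"
  have "indep_var (PiM {p} (\<lambda>_. borel)) (\<lambda>\<omega>. restrict (\<lambda>i. e i \<omega>) {p})
                  (PiM ?B (\<lambda>_. borel)) (\<lambda>\<omega>. restrict (\<lambda>i. e i \<omega>) ?B)"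
    using assms by (intro indep_var_restrict[OF indep]) auto
  then have "indep_var borel ((\<lambda>x. x p) \<circ> (\<lambda>\<omega>. restrict (\<lambda>i. e i \<omega>) {p}))
      borel ((\<lambda>x. x q * x r * x s) \<circ> (\<lambda>\<omega>. restrict (\<lambda>i. e i \<omega>) ?B))"
    by (rule indep_var_compose)
       (auto intro!: borel_measurable_times measurable_component_singleton)
  then have "indep_var borel (e p) borel (\<lambda>\<omega>. e q \<omega> * e r \<omega> * e s \<omega>)"
    by (simp add: o_def)
  then show ?thesis
    using indep_var_lebesgue_integral[OF _ integrable_e1 integrable_e3] by (simp add: mean)
qed

lemma indep_pair:
  assumes "p \<noteq> q" "f \<in> borel_measurable borel" "g \<in> borel_measurable borel"
  shows "indep_var borel (\<lambda>\<omega>. f (e p \<omega>) :: real) borel (\<lambda>\<omega>. g (e q \<omega>) :: real)"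
proof -
  have "indep_var (PiM {p} (\<lambda>_. borel)) (\<lambda>\<omega>. restrict (\<lambda>i. e i \<omega>) {p})
                  (PiM {q} (\<lambda>_. borel)) (\<lambda>\<omega>. restrict (\<lambda>i. e i \<omega>) {q})"
    using assms by (intro indep_var_restrict[OF indep]) auto
  then have "indep_var borel ((\<lambda>x. f (x p)) \<circ> (\<lambda>\<omega>. restrict (\<lambda>i. e i \<omega>) {p}))
      borel ((\<lambda>x. g (x q)) \<circ> (\<lambda>\<omega>. restrict (\<lambda>i. e i \<omega>) {q}))"
    by (rule indep_var_compose)
       (auto intro!: measurable_compose[OF _ assms(2)] measurable_compose[OF _ assms(3)]
         measurable_component_singleton)
  then show ?thesis by (simp add: o_def)
qed

definition centred_product :: "int \<Rightarrow> int \<Rightarrow> 'a \<Rightarrow> real" where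
  "centred_product p q \<omega> = e p \<omega> * e q \<omega> - (if p = q then s2 else 0)"

lemma measurable_centred_product [measurable]: "centred_product p q \<in> borel_measurable M"
  unfolding centred_product_def by measurable

lemma integrable_centred_product: "integrable M (centred_product p q)"
  unfolding centred_product_def by (intro Bochner_Integration.integrable_diff integrable_e2 integrable_const)

lemma expectation_centred_product: "expectation (centred_product p q) = 0"
proof (cases "p = q")
  case True
  then show ?thesis
    using second[of q] integrable_e2[of q q]
    unfolding centred_product_def[abs_def] by (simp add: power2_eq_square prob_space)
next
  case False
  then show ?thesis
    using indep_var_lebesgue_integral[OF indep_pair[OF False, of "\<lambda>x. x" "\<lambda>x. x"] integrable_e1 integrable_e1]
    unfolding centred_product_def[abs_def] using False by (simp add: mean)
qed

lemma integrable_centred_product_mult: "integrable M (\<lambda>\<omega>. centred_product p q \<omega> * centred_product r s \<omega>)"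
proof -
  have "(\<lambda>\<omega>. centred_product p q \<omega> * centred_product r s \<omega>) = (\<lambda>\<omega>. e p \<omega> * e q \<omega> * (e r \<omega> * e s \<omega>)
      - (e p \<omega> * e q \<omega>) * (if r = s then s2 else 0) - (if p = q then s2 else 0) * (e r \<omega> * e s \<omega>)
      + (if p = q then s2 else 0) * (if r = s then s2 else 0))"
    by (auto simp: centred_product_def algebra_simps fun_eq_iff)
  then show ?thesis
    by (simp only:) (intro Bochner_Integration.integrable_add Bochner_Integration.integrable_diff
        integrable_mult_left integrable_mult_right integrable_e4 integrable_e2 integrable_const)
qed

text \<open>
  A bound on the variance of a product of two noise variables that does not depend on the two time indices.
\<close>
definition centred_square_bound :: real where "centred_square_bound = 2 * m4 + 2 * s2\<^sup>2"

lemma centred_square_bound_nonneg: "centred_square_bound \<ge> 0"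
proof -
  have "0 \<le> m4" unfolding fourth[of 0, symmetric] by (intro integral_nonneg_AE AE_I2) auto
  then show ?thesis by (simp add: centred_square_bound_def)
qed

lemma expectation_centred_product_square: "expectation (\<lambda>\<omega>. (centred_product p q \<omega>)\<^sup>2) \<le> centred_square_bound"
proof -
  have "expectation (\<lambda>\<omega>. (centred_product p q \<omega>)\<^sup>2)
      \<le> expectation (\<lambda>\<omega>. (e p \<omega> ^ 4 + e q \<omega> ^ 4) + 2 * s2\<^sup>2)"
  proof (rule integral_mono)
    show "integrable M (\<lambda>\<omega>. (centred_product p q \<omega>)\<^sup>2)"
      unfolding power2_eq_square by (rule integrable_centred_product_mult)
    show "integrable M (\<lambda>\<omega>. (e p \<omega> ^ 4 + e q \<omega> ^ 4) + 2 * s2\<^sup>2)"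
      by (intro Bochner_Integration.integrable_add fourth_integrable integrable_const)
    fix \<omega>
    let ?x = "e p \<omega> * e q \<omega>" and ?d = "if p = q then s2 else 0"
    have "(?x - ?d)\<^sup>2 \<le> 2 * ?x\<^sup>2 + 2 * ?d\<^sup>2"
      using sum_squares_bound[of ?x "- ?d"] by (simp add: power2_diff)
    moreover have "2 * ?x\<^sup>2 \<le> e p \<omega> ^ 4 + e q \<omega> ^ 4"
      using sum_squares_bound[of "(e p \<omega>)\<^sup>2" "(e q \<omega>)\<^sup>2"] by (simp add: power_mult_distrib)
    moreover have "?d\<^sup>2 \<le> s2\<^sup>2" by simp
    ultimately show "(centred_product p q \<omega>)\<^sup>2 \<le> (e p \<omega> ^ 4 + e q \<omega> ^ 4) + 2 * s2\<^sup>2"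
      unfolding centred_product_def by linarith
  qed
  also have "\<dots> = centred_square_bound"
    using fourth_integrable by (simp add: fourth centred_square_bound_def prob_space)
  finally show ?thesis .
qed

text \<open>
  For lag 0 the two factors are functions of different noise variables. For nonzero lag, among the four
  indices at least one differs from the other three, and its variable has mean zero: this is
  \<open>p\<close> unless \<open>p = s\<close>, and in that case it is \<open>q\<close>, since
  \<open>q = r\<close> would force the lags to have opposite signs.
\<close>
lemma centred_products_uncorrelated:
  assumes lag: "p - q = r - s" and ne: "p \<noteq> r"
  shows "expectation (\<lambda>\<omega>. centred_product p q \<omega> * centred_product r s \<omega>) = 0"
proof (cases "p = q")
  case True
  with lag have "r = s" by simp
  have "indep_var borel (\<lambda>\<omega>. (e p \<omega>)\<^sup>2 - s2) borel (\<lambda>\<omega>. (e r \<omega>)\<^sup>2 - s2)"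
    by (rule indep_pair[OF ne, of "\<lambda>x. x\<^sup>2 - s2" "\<lambda>x. x\<^sup>2 - s2"]) auto
  moreover have "(\<lambda>\<omega>. (e p \<omega>)\<^sup>2 - s2) = centred_product p q" "(\<lambda>\<omega>. (e r \<omega>)\<^sup>2 - s2) = centred_product r s"
    using \<open>p = q\<close> \<open>r = s\<close> by (simp_all add: centred_product_def fun_eq_iff power2_eq_square)
  ultimately have "indep_var borel (centred_product p q) borel (centred_product r s)"
    by simp
  from indep_var_lebesgue_integral[OF this integrable_centred_product integrable_centred_product]
  show ?thesis by (simp add: expectation_centred_product)
next
  case False
  with lag have rs: "r \<noteq> s" by simp
  have prod: "centred_product p q \<omega> * centred_product r s \<omega> = e p \<omega> * e q \<omega> * (e r \<omega> * e s \<omega>)" for \<omega>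
    using False rs by (simp add: centred_product_def)
  show ?thesis
  proof (cases "p = s")
    case False
    with \<open>p \<noteq> q\<close> ne have "p \<notin> {q, r, s}" by simp
    from expectation_isolated_factor[OF this] show ?thesis
      by (simp add: prod mult.assoc)
  next
    case True
    with \<open>p \<noteq> q\<close> ne lag have "q \<notin> {p, r, s}" by auto
    from expectation_isolated_factor[OF this] show ?thesis
      by (simp add: prod ac_simps)
  qed
qed

text \<open>
  By orthogonality the second moment of the sum is the sum of the second moments. The bound is the same for
  all lags \<open>k\<close> and \<open>l\<close>, which allows summation against the coefficients of a
  linear process.
\<close>
lemma expectation_sum_centred_product_square:
  assumes T: "finite T"
  shows "integrable M (\<lambda>\<omega>. (\<Sum>t\<in>T. centred_product (t - k) (t - l) \<omega>)\<^sup>2)"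
    and "expectation (\<lambda>\<omega>. (\<Sum>t\<in>T. centred_product (t - k) (t - l) \<omega>)\<^sup>2) \<le> centred_square_bound * real (card T)"
proof -
  have sq: "(\<Sum>t\<in>T. centred_product (t - k) (t - l) \<omega>)\<^sup>2
      = (\<Sum>t\<in>T. \<Sum>t'\<in>T. centred_product (t - k) (t - l) \<omega> * centred_product (t' - k) (t' - l) \<omega>)" for \<omega>
    by (simp add: power2_eq_square sum_product)
  show "integrable M (\<lambda>\<omega>. (\<Sum>t\<in>T. centred_product (t - k) (t - l) \<omega>)\<^sup>2)"
    unfolding sq by (intro Bochner_Integration.integrable_sum integrable_centred_product_mult)
  have "expectation (\<lambda>\<omega>. (\<Sum>t\<in>T. centred_product (t - k) (t - l) \<omega>)\<^sup>2)
      = (\<Sum>t\<in>T. \<Sum>t'\<in>T. expectation (\<lambda>\<omega>. centred_product (t - k) (t - l) \<omega> * centred_product (t' - k) (t' - l) \<omega>))"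
    unfolding sq
    by (simp add: Bochner_Integration.integral_sum Bochner_Integration.integrable_sum integrable_centred_product_mult)
  also have "\<dots> = (\<Sum>t\<in>T. \<Sum>t'\<in>T. if t = t' then expectation (\<lambda>\<omega>. (centred_product (t - k) (t - l) \<omega>)\<^sup>2) else 0)"
    by (intro sum.cong refl) (auto simp: power2_eq_square intro!: centred_products_uncorrelated)
  also have "\<dots> = (\<Sum>t\<in>T. expectation (\<lambda>\<omega>. (centred_product (t - k) (t - l) \<omega>)\<^sup>2))"
    using T by simp
  also have "\<dots> \<le> (\<Sum>t\<in>T. centred_square_bound)"
    by (intro sum_mono expectation_centred_product_square)
  finally show "expectation (\<lambda>\<omega>. (\<Sum>t\<in>T. centred_product (t - k) (t - l) \<omega>)\<^sup>2) \<le> centred_square_bound * real (card T)"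
    by (simp add: mult.commute)
qed

section \<open>Sample covariances of linear processes\<close>

definition truncated :: "(nat \<Rightarrow> real) \<Rightarrow> nat \<Rightarrow> int \<Rightarrow> 'a \<Rightarrow> real" where
  "truncated a K t \<omega> = (\<Sum>k<K. a k * e (t - int k) \<omega>)"

lemma measurable_truncated [measurable]: "truncated a K t \<in> borel_measurable M"
  unfolding truncated_def by measurable

lemma sum_truncated_product:
  "(\<Sum>t\<in>T. truncated a K t \<omega> * truncated b K t \<omega>) - real (card T) * (s2 * (\<Sum>k<K. a k * b k))
     = (\<Sum>k<K. \<Sum>l<K. a k * b l * (\<Sum>t\<in>T. centred_product (t - int k) (t - int l) \<omega>))"
proof -
  have "truncated a K t \<omega> * truncated b K t \<omega> - s2 * (\<Sum>k<K. a k * b k)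
      = (\<Sum>k<K. \<Sum>l<K. a k * b l * centred_product (t - int k) (t - int l) \<omega>)" for t
  proof -
    have "(\<Sum>k<K. \<Sum>l<K. a k * b l * centred_product (t - int k) (t - int l) \<omega>)
        = (\<Sum>k<K. \<Sum>l<K. a k * e (t - int k) \<omega> * (b l * e (t - int l) \<omega>))
          - (\<Sum>k<K. \<Sum>l<K. if l = k then s2 * (a k * b k) else 0)"
      unfolding sum_subtractf[symmetric]
      by (intro sum.cong refl) (auto simp: centred_product_def algebra_simps)
    also have "\<dots> = truncated a K t \<omega> * truncated b K t \<omega> - s2 * (\<Sum>k<K. a k * b k)"
      by (simp add: truncated_def sum_product sum.delta) (simp add: sum_distrib_left)
    finally show ?thesis by simp
  qed
  then have "(\<Sum>t\<in>T. truncated a K t \<omega> * truncated b K t \<omega>) - real (card T) * (s2 * (\<Sum>k<K. a k * b k))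
      = (\<Sum>t\<in>T. \<Sum>k<K. \<Sum>l<K. a k * b l * centred_product (t - int k) (t - int l) \<omega>)"
    by (simp only: sum_minus_const)
  also have "\<dots> = (\<Sum>k<K. \<Sum>l<K. \<Sum>t\<in>T. a k * b l * centred_product (t - int k) (t - int l) \<omega>)"
    by (subst sum.swap, intro sum.cong refl, rule sum.swap)
  finally show ?thesis by (simp add: sum_distrib_left)
qed

text \<open>
  The centred sum is a combination of the sums in \<open>expectation_sum_centred_product_square\<close>,
  with weights \<open>a k * b l\<close> of total mass at most
  \<open>(\<Sum>k. \<bar>a k\<bar>) * (\<Sum>k. \<bar>b k\<bar>)\<close>. The bound does not depend
  on the truncation point \<open>K\<close>.
\<close>
lemma sum_truncated_second_moment:
  assumes a: "summable (\<lambda>k. \<bar>a k\<bar>)" and b: "summable (\<lambda>k. \<bar>b k\<bar>)" and T: "finite T"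
  shows "(\<integral>\<^sup>+\<omega>. ennreal (((\<Sum>t\<in>T. truncated a K t \<omega> * truncated b K t \<omega>)
             - real (card T) * (s2 * (\<Sum>k<K. a k * b k)))\<^sup>2) \<partial>M)
         \<le> ennreal (((\<Sum>k. \<bar>a k\<bar>) * (\<Sum>k. \<bar>b k\<bar>))\<^sup>2 * (centred_square_bound * real (card T)))"
proof -
  define Y where "Y i \<omega> = (\<Sum>t\<in>T. centred_product (t - int (fst i)) (t - int (snd i)) \<omega>)" for i \<omega>
  define c where "c i = a (fst i) * b (snd i)" for i :: "nat \<times> nat"
  define I where "I = {..<K} \<times> {..<K}"
  let ?H = "(\<Sum>k. \<bar>a k\<bar>) * (\<Sum>k. \<bar>b k\<bar>)"
  have H0: "0 \<le> ?H" by (intro mult_nonneg_nonneg suminf_nonneg a b) auto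
  have cI: "(\<Sum>i\<in>I. \<bar>c i\<bar>) \<le> ?H"
  proof -
    have "(\<Sum>i\<in>I. \<bar>c i\<bar>) = (\<Sum>k<K. \<bar>a k\<bar>) * (\<Sum>k<K. \<bar>b k\<bar>)"
      by (simp add: I_def c_def abs_mult sum_product sum.cartesian_product case_prod_beta)
    also have "\<dots> \<le> ?H"
      by (intro mult_mono sum_le_suminf suminf_nonneg a b) (auto intro: sum_nonneg)
    finally show ?thesis .
  qed
  have Yint: "integrable M (\<lambda>\<omega>. (Y i \<omega>)\<^sup>2)"
    and Ybound: "expectation (\<lambda>\<omega>. (Y i \<omega>)\<^sup>2) \<le> centred_square_bound * real (card T)" for i
    unfolding Y_def by (rule expectation_sum_centred_product_square[OF T])+
  have D: "(\<Sum>t\<in>T. truncated a K t \<omega> * truncated b K t \<omega>) - real (card T) * (s2 * (\<Sum>k<K. a k * b k))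
      = (\<Sum>i\<in>I. c i * Y i \<omega>)" for \<omega>
    unfolding sum_truncated_product I_def c_def Y_def by (simp add: sum.cartesian_product case_prod_beta)
  have "(\<integral>\<^sup>+\<omega>. ennreal ((\<Sum>i\<in>I. c i * Y i \<omega>)\<^sup>2) \<partial>M)
      \<le> (\<integral>\<^sup>+\<omega>. ennreal (?H * (\<Sum>i\<in>I. \<bar>c i\<bar> * (Y i \<omega>)\<^sup>2)) \<partial>M)"
    by (intro nn_integral_mono ennreal_leI order_trans[OF square_weighted_sum_le] mult_right_mono cI)
       (auto intro: sum_nonneg)
  also have "\<dots> = ennreal (expectation (\<lambda>\<omega>. ?H * (\<Sum>i\<in>I. \<bar>c i\<bar> * (Y i \<omega>)\<^sup>2)))"
    using H0 by (intro nn_integral_eq_integral integrable_mult_right Bochner_Integration.integrable_sum Yint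
        AE_I2 mult_nonneg_nonneg[OF H0] sum_nonneg) auto
  also have "\<dots> \<le> ennreal (?H * (?H * (centred_square_bound * real (card T))))"
  proof (rule ennreal_leI)
    have "expectation (\<lambda>\<omega>. ?H * (\<Sum>i\<in>I. \<bar>c i\<bar> * (Y i \<omega>)\<^sup>2))
        = ?H * (\<Sum>i\<in>I. \<bar>c i\<bar> * expectation (\<lambda>\<omega>. (Y i \<omega>)\<^sup>2))"
      using Yint by (simp add: Bochner_Integration.integral_sum)
    also have "\<dots> \<le> ?H * (\<Sum>i\<in>I. \<bar>c i\<bar> * (centred_square_bound * real (card T)))"
      using H0 by (intro mult_left_mono sum_mono Ybound) auto
    also have "\<dots> = ?H * ((\<Sum>i\<in>I. \<bar>c i\<bar>) * (centred_square_bound * real (card T)))"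
      by (simp add: sum_distrib_right)
    also have "\<dots> \<le> ?H * (?H * (centred_square_bound * real (card T)))"
      using H0 cI centred_square_bound_nonneg by (intro mult_left_mono mult_right_mono) auto
    finally show "expectation (\<lambda>\<omega>. ?H * (\<Sum>i\<in>I. \<bar>c i\<bar> * (Y i \<omega>)\<^sup>2))
        \<le> ?H * (?H * (centred_square_bound * real (card T)))" .
  qed
  finally show ?thesis
    unfolding D by (simp add: power2_eq_square ac_simps)
qed

text \<open>
  Fatou's lemma as the truncation point tends to infinity.
\<close>
lemma sum_product_second_moment:
  assumes a: "summable (\<lambda>k. \<bar>a k\<bar>)" and b: "summable (\<lambda>k. \<bar>b k\<bar>)" and T: "finite T"
    and w: "\<And>t. t \<in> T \<Longrightarrow> AE \<omega> in M. (\<lambda>k. a k * e (t - int k) \<omega>) sums w t \<omega>"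
    and z: "\<And>t. t \<in> T \<Longrightarrow> AE \<omega> in M. (\<lambda>k. b k * e (t - int k) \<omega>) sums z t \<omega>"
  shows "(\<integral>\<^sup>+\<omega>. ennreal (((\<Sum>t\<in>T. w t \<omega> * z t \<omega>) - real (card T) * (s2 * (\<Sum>k. a k * b k)))\<^sup>2) \<partial>M)
         \<le> ennreal (((\<Sum>k. \<bar>a k\<bar>) * (\<Sum>k. \<bar>b k\<bar>))\<^sup>2 * (centred_square_bound * real (card T)))"
    (is "integral\<^sup>N M (\<lambda>\<omega>. ennreal ((?D \<omega>)\<^sup>2)) \<le> ?B")
proof -
  let ?DK = "\<lambda>K \<omega>. (\<Sum>t\<in>T. truncated a K t \<omega> * truncated b K t \<omega>)
             - real (card T) * (s2 * (\<Sum>k<K. a k * b k))"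
  have ab: "summable (\<lambda>k. a k * b k)"
    by (rule summable_mult_of_summable_abs[OF a b])
  have "AE \<omega> in M. \<forall>t\<in>T. (\<lambda>k. a k * e (t - int k) \<omega>) sums w t \<omega> \<and> (\<lambda>k. b k * e (t - int k) \<omega>) sums z t \<omega>"
    using T w z by (intro AE_finite_allI AE_conjI) auto
  then have "AE \<omega> in M. ennreal ((?D \<omega>)\<^sup>2) = liminf (\<lambda>K. ennreal ((?DK K \<omega>)\<^sup>2))"
  proof eventually_elim
    case (elim \<omega>)
    then have "(\<lambda>K. ?DK K \<omega>) \<longlonglongrightarrow> ?D \<omega>"
      using ab unfolding truncated_def sums_def
      by (intro tendsto_intros) (auto simp: summable_LIMSEQ)
    then have "(\<lambda>K. ennreal ((?DK K \<omega>)\<^sup>2)) \<longlonglongrightarrow> ennreal ((?D \<omega>)\<^sup>2)"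
      by (intro tendsto_ennrealI tendsto_power)
    then show ?case
      by (rule lim_imp_Liminf[OF trivial_limit_sequentially, symmetric])
  qed
  then have "integral\<^sup>N M (\<lambda>\<omega>. ennreal ((?D \<omega>)\<^sup>2)) = (\<integral>\<^sup>+\<omega>. liminf (\<lambda>K. ennreal ((?DK K \<omega>)\<^sup>2)) \<partial>M)"
    by (rule nn_integral_cong_AE)
  also have "\<dots> \<le> liminf (\<lambda>K. \<integral>\<^sup>+\<omega>. ennreal ((?DK K \<omega>)\<^sup>2) \<partial>M)"
    by (rule nn_integral_liminf) measurable
  also have "\<dots> \<le> liminf (\<lambda>K. ?B)"
    by (intro Liminf_mono always_eventually allI sum_truncated_second_moment a b T)
  also have "\<dots> = ?B" by (simp add: Liminf_const)
  finally show ?thesis .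
qed

text \<open>
  With \<open>m\<^sup>2\<close> summands the mean square error of the sample covariance is of order
  \<open>1 / m\<^sup>2\<close>, which is summable; with \<open>m\<close> summands it would only be of
  order \<open>1 / m\<close>.
\<close>
lemma sample_covariance_limit:
  assumes a: "summable (\<lambda>k. \<bar>a k\<bar>)" and b: "summable (\<lambda>k. \<bar>b k\<bar>)"
    and T: "\<And>m. finite (T m)" "\<And>m. card (T m) = m\<^sup>2"
    and w: "\<And>m t. t \<in> T m \<Longrightarrow> AE \<omega> in M. (\<lambda>k. a k * e (t - int k) \<omega>) sums w t \<omega>"
    and z: "\<And>m t. t \<in> T m \<Longrightarrow> AE \<omega> in M. (\<lambda>k. b k * e (t - int k) \<omega>) sums z t \<omega>"
    and meas: "\<And>m t. t \<in> T m \<Longrightarrow> w t \<in> borel_measurable M" "\<And>m t. t \<in> T m \<Longrightarrow> z t \<in> borel_measurable M"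
  shows "AE \<omega> in M. (\<lambda>m. (\<Sum>t\<in>T m. w t \<omega> * z t \<omega>) / real (m\<^sup>2)) \<longlonglongrightarrow> s2 * (\<Sum>k. a k * b k)"
proof -
  let ?\<rho> = "s2 * (\<Sum>k. a k * b k)"
  let ?D = "\<lambda>m \<omega>. (\<Sum>t\<in>T m. w t \<omega> * z t \<omega>) - real (m\<^sup>2) * ?\<rho>"
  let ?B = "((\<Sum>k. \<bar>a k\<bar>) * (\<Sum>k. \<bar>b k\<bar>))\<^sup>2 * centred_square_bound"
  have B: "?B \<ge> 0" using centred_square_bound_nonneg by simp
  have "AE \<omega> in M. summable (\<lambda>m. (?D m \<omega> / real (m\<^sup>2))\<^sup>2)"
  proof (rule AE_summable_of_expectations)
    show "(\<lambda>\<omega>. (?D m \<omega> / real (m\<^sup>2))\<^sup>2) \<in> borel_measurable M" for m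
      using meas[of _ m] by (intro borel_measurable_power borel_measurable_divide borel_measurable_diff
          borel_measurable_sum borel_measurable_times borel_measurable_const)
    show "summable (\<lambda>m. ?B * (1 / real m ^ 2))"
      using inverse_power_summable[of 2, where ?'a = real] by (intro summable_mult) (simp add: inverse_eq_divide)
    show "(\<integral>\<^sup>+\<omega>. ennreal ((?D m \<omega> / real (m\<^sup>2))\<^sup>2) \<partial>M) \<le> ennreal (?B * (1 / real m ^ 2))" for m
    proof (cases "m = 0")
      case False
      let ?c = "1 / real m ^ 4"
      have meas_D: "(\<lambda>\<omega>. ennreal ((?D m \<omega>)\<^sup>2)) \<in> borel_measurable M"
        using meas[of _ m] by (intro measurable_compose[OF _ measurable_ennreal] borel_measurable_power
            borel_measurable_diff borel_measurable_sum borel_measurable_times borel_measurable_const)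
      have "(\<integral>\<^sup>+\<omega>. ennreal ((?D m \<omega> / real (m\<^sup>2))\<^sup>2) \<partial>M)
          = (\<integral>\<^sup>+\<omega>. ennreal ?c * ennreal ((?D m \<omega>)\<^sup>2) \<partial>M)"
        by (subst ennreal_mult'[symmetric]) (auto simp: power_divide power_mult[symmetric])
      also have "\<dots> = ennreal ?c * (\<integral>\<^sup>+\<omega>. ennreal ((?D m \<omega>)\<^sup>2) \<partial>M)"
        using meas_D by (rule nn_integral_cmult)
      also have "\<dots> \<le> ennreal ?c * ennreal (((\<Sum>k. \<bar>a k\<bar>) * (\<Sum>k. \<bar>b k\<bar>))\<^sup>2 * (centred_square_bound * real (m\<^sup>2)))"
        using sum_product_second_moment[OF a b T(1)[of m] w z] unfolding T(2)
        by (intro mult_left_mono) auto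
      also have "\<dots> = ennreal (?B * (1 / real m ^ 2))"
      proof -
        have c: "?c * (real m)\<^sup>2 = 1 / real m ^ 2"
          using False by (simp add: field_simps power_add[symmetric])
        have "?c * (((\<Sum>k. \<bar>a k\<bar>) * (\<Sum>k. \<bar>b k\<bar>))\<^sup>2 * (centred_square_bound * real (m\<^sup>2))) = ?B * (?c * (real m)\<^sup>2)"
          by (simp add: ac_simps)
        then show ?thesis
          unfolding c by (simp only: ennreal_mult'[symmetric] zero_le_divide_1_iff zero_le_power of_nat_0_le_iff)
      qed
      finally show ?thesis .
    qed simp
  qed (use B in auto)
  then show ?thesis
  proof eventually_elim
    case (elim \<omega>)
    then have "(\<lambda>m. (?D m \<omega> / real (m\<^sup>2))\<^sup>2) \<longlonglongrightarrow> 0"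
      by (rule summable_LIMSEQ_zero)
    then have "(\<lambda>m. ?D m \<omega> / real (m\<^sup>2)) \<longlonglongrightarrow> 0"
      by (simp add: power_tendsto_0_iff)
    then have "(\<lambda>m. ?D m \<omega> / real (m\<^sup>2) + ?\<rho>) \<longlonglongrightarrow> 0 + ?\<rho>"
      by (intro tendsto_intros)
    moreover have "\<forall>\<^sub>F m in sequentially. ?D m \<omega> / real (m\<^sup>2) + ?\<rho>
        = (\<Sum>t\<in>T m. w t \<omega> * z t \<omega>) / real (m\<^sup>2)"
      using eventually_gt_at_top[of 0] by eventually_elim (simp add: field_simps)
    ultimately show ?case by (simp add: Lim_transform_eventually)
  qed
qed

text \<open>
  An integrable bound for the squares of all truncations at once, obtained from
  \<open>square_weighted_sum_le\<close>.
\<close>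
definition envelope :: "(nat \<Rightarrow> real) \<Rightarrow> int \<Rightarrow> 'a \<Rightarrow> real" where
  "envelope a t \<omega> = (\<Sum>k. \<bar>a k\<bar>) * (\<Sum>k. \<bar>a k\<bar> * (e (t - int k) \<omega>)\<^sup>2)"

lemma envelope_dominates:
  assumes a: "summable (\<lambda>k. \<bar>a k\<bar>)"
  shows "integrable M (envelope a t)"
    and "AE \<omega> in M. \<forall>K. (truncated a K t \<omega>)\<^sup>2 \<le> envelope a t \<omega>"
proof -
  let ?f = "\<lambda>k \<omega>. \<bar>a k\<bar> * (e (t - int k) \<omega>)\<^sup>2"
  have int: "integrable M (\<lambda>\<omega>. (e s \<omega>)\<^sup>2)" for s
    unfolding power2_eq_square by (rule integrable_e2)
  have E: "(\<integral>\<omega>. ?f k \<omega> \<partial>M) = \<bar>a k\<bar> * s2" for k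
    by (simp add: second int)
  have s2: "s2 \<ge> 0" unfolding second[of 0, symmetric] by (intro integral_nonneg_AE AE_I2) auto
  have sum: "AE \<omega> in M. summable (\<lambda>k. ?f k \<omega>)"
  proof (rule AE_summable_of_expectations)
    show "(\<integral>\<^sup>+\<omega>. ennreal (?f k \<omega>) \<partial>M) \<le> ennreal (\<bar>a k\<bar> * s2)" for k
      using int by (subst nn_integral_eq_integral) (auto simp: second)
  qed (use a s2 in \<open>auto intro: summable_mult2\<close>)
  have "integrable M (\<lambda>\<omega>. \<Sum>k. ?f k \<omega>)"
  proof (rule integrable_suminf)
    show "AE \<omega> in M. summable (\<lambda>k. norm (?f k \<omega>))" using sum by simp
    show "summable (\<lambda>k. \<integral>\<omega>. norm (?f k \<omega>) \<partial>M)"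
      using a by (simp add: second summable_mult2)
  qed (use int in auto)
  then show "integrable M (envelope a t)"
    unfolding envelope_def[abs_def] by simp
  show "AE \<omega> in M. \<forall>K. (truncated a K t \<omega>)\<^sup>2 \<le> envelope a t \<omega>"
    using sum
  proof eventually_elim
    case (elim \<omega>)
    show ?case
    proof
      fix K
      have "(truncated a K t \<omega>)\<^sup>2 \<le> (\<Sum>k<K. \<bar>a k\<bar>) * (\<Sum>k<K. ?f k \<omega>)"
        unfolding truncated_def by (rule square_weighted_sum_le)
      also have "\<dots> \<le> envelope a t \<omega>"
        unfolding envelope_def using a elim
        by (intro mult_mono sum_le_suminf suminf_nonneg) (auto intro: sum_nonneg)
      finally show "(truncated a K t \<omega>)\<^sup>2 \<le> envelope a t \<omega>" .
    qed
  qed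
qed

lemma expectation_truncated_product:
  "expectation (\<lambda>\<omega>. truncated a K t \<omega> * truncated b K t \<omega>) = s2 * (\<Sum>k<K. a k * b k)"
proof -
  have eq: "truncated a K t \<omega> * truncated b K t \<omega> =
      (\<Sum>k<K. \<Sum>l<K. a k * b l * centred_product (t - int k) (t - int l) \<omega>) + s2 * (\<Sum>k<K. a k * b k)" for \<omega>
    using sum_truncated_product[of a K \<omega> b "{t}"] by simp
  have "expectation (\<lambda>\<omega>. truncated a K t \<omega> * truncated b K t \<omega>)
      = (\<Sum>k<K. \<Sum>l<K. a k * b l * expectation (centred_product (t - int k) (t - int l))) + s2 * (\<Sum>k<K. a k * b k)"
    unfolding eq by (simp add: integrable_centred_product prob_space)
  then show ?thesis by (simp add: expectation_centred_product)
qed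

text \<open>
  Dominated convergence from the truncated processes. The envelope bounds their squares, hence also, by
  \<open>2 \<bar>x\<bar> \<le> 1 + x\<^sup>2\<close> and
  \<open>2 \<bar>x y\<bar> \<le> x\<^sup>2 + y\<^sup>2\<close>, the variables themselves and their
  products.
\<close>
lemma linear_process_moments:
  assumes a: "summable (\<lambda>k. \<bar>a k\<bar>)" and b: "summable (\<lambda>k. \<bar>b k\<bar>)"
    and w: "AE \<omega> in M. (\<lambda>k. a k * e (t - int k) \<omega>) sums w \<omega>"
    and z: "AE \<omega> in M. (\<lambda>k. b k * e (t - int k) \<omega>) sums z \<omega>"
    and [measurable]: "w \<in> borel_measurable M" "z \<in> borel_measurable M"
  shows "expectation w = 0"
    and "expectation (\<lambda>\<omega>. w \<omega> * z \<omega>) = s2 * (\<Sum>k. a k * b k)"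
proof -
  have lim_w: "AE \<omega> in M. (\<lambda>K. truncated a K t \<omega>) \<longlonglongrightarrow> w \<omega>"
    using w by (simp add: truncated_def sums_def)
  have lim_z: "AE \<omega> in M. (\<lambda>K. truncated b K t \<omega>) \<longlonglongrightarrow> z \<omega>"
    using z by (simp add: truncated_def sums_def)
  have "(\<lambda>K. expectation (truncated a K t)) \<longlonglongrightarrow> expectation w"
  proof (rule integral_dominated_convergence)
    show "integrable M (\<lambda>\<omega>. 1 + envelope a t \<omega>)"
      using envelope_dominates(1)[OF a] by simp
    show "AE \<omega> in M. norm (truncated a K t \<omega>) \<le> 1 + envelope a t \<omega>" for K
      using envelope_dominates(2)[OF a, of t]
    proof eventually_elim
      case (elim \<omega>)
      have "2 * \<bar>truncated a K t \<omega>\<bar> \<le> 1 + (truncated a K t \<omega>)\<^sup>2"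
        using sum_squares_bound[of 1 "\<bar>truncated a K t \<omega>\<bar>"] by simp
      then show ?case using elim[rule_format, of K] zero_le_power2[of "truncated a K t \<omega>"]
        by simp
    qed
  qed (use lim_w in auto)
  moreover have "expectation (truncated a K t) = 0" for K
    unfolding truncated_def[abs_def] by (simp add: integrable_e1 mean)
  ultimately show "expectation w = 0"
    by (simp add: LIMSEQ_const_iff)
  have "(\<lambda>K. expectation (\<lambda>\<omega>. truncated a K t \<omega> * truncated b K t \<omega>)) \<longlonglongrightarrow> expectation (\<lambda>\<omega>. w \<omega> * z \<omega>)"
  proof (rule integral_dominated_convergence)
    show "integrable M (\<lambda>\<omega>. envelope a t \<omega> + envelope b t \<omega>)"
      using envelope_dominates(1)[OF a] envelope_dominates(1)[OF b] by simp
    show "AE \<omega> in M. norm (truncated a K t \<omega> * truncated b K t \<omega>) \<le> envelope a t \<omega> + envelope b t \<omega>" for K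
      using envelope_dominates(2)[OF a, of t] envelope_dominates(2)[OF b, of t]
    proof eventually_elim
      case (elim \<omega>)
      let ?x = "truncated a K t \<omega>" and ?y = "truncated b K t \<omega>"
      have "2 * \<bar>?x * ?y\<bar> \<le> ?x\<^sup>2 + ?y\<^sup>2"
        using sum_squares_bound[of "\<bar>?x\<bar>" "\<bar>?y\<bar>"] by (simp add: abs_mult)
      then show ?case
        using elim(1)[rule_format, of K] elim(2)[rule_format, of K]
          zero_le_power2[of ?x] zero_le_power2[of ?y] unfolding real_norm_def by linarith
    qed
    show "AE \<omega> in M. (\<lambda>K. truncated a K t \<omega> * truncated b K t \<omega>) \<longlonglongrightarrow> w \<omega> * z \<omega>"
      using lim_w lim_z by eventually_elim (rule tendsto_mult)
  qed auto
  moreover have "(\<lambda>K. s2 * (\<Sum>k<K. a k * b k)) \<longlonglongrightarrow> s2 * (\<Sum>k. a k * b k)"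
    by (intro tendsto_mult_left summable_LIMSEQ summable_mult_of_summable_abs a b)
  ultimately show "expectation (\<lambda>\<omega>. w \<omega> * z \<omega>) = s2 * (\<Sum>k. a k * b k)"
    unfolding expectation_truncated_product by (rule LIMSEQ_unique)
qed

section \<open>Growth of the Gram matrix\<close>

text \<open>
  The entry for \<open>p \<le> q\<close> involves \<open>u(t - p)\<close> and
  \<open>u(t - q)\<close>. Both are linear processes driven by the noise up to time
  \<open>t - p\<close>, the second with the coefficients of \<open>h\<close> delayed by
  \<open>d = q - p\<close>. The pair \<open>u(q - 1)\<close>, \<open>u(p - 1)\<close> from the
  covariance matrix has the same two coefficient sequences with respect to time \<open>q - 1\<close>, so
  both quantities equal \<open>s2\<close> times the inner product of these sequences.
\<close>
lemma AE_gram_limit: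
  fixes idx :: "'n::finite \<Rightarrow> nat" and u :: "int \<Rightarrow> 'a \<Rightarrow> real"
  assumes idx: "\<And>i. idx i \<in> {1..CARD('n)}"
    and h: "summable (\<lambda>k. \<bar>h k\<bar>)"
    and u: "\<And>t. t \<ge> 1 - int CARD('n) \<Longrightarrow> AE \<omega> in M. (\<lambda>k. h k * e (t - int k) \<omega>) sums u t \<omega>"
    and meas: "\<And>t. t \<ge> 1 - int CARD('n) \<Longrightarrow> u t \<in> borel_measurable M"
  shows "AE \<omega> in M. \<forall>i j. (\<lambda>m. gram idx u (m\<^sup>2) \<omega> $ i $ j / real (m\<^sup>2))
           \<longlonglongrightarrow> covariance_matrix M (\<lambda>i. u (int (idx i) - 1)) $ i $ j"
proof -
  have ordered: "AE \<omega> in M. (\<lambda>m. (\<Sum>t=1..m\<^sup>2. u (int t - int p) \<omega> * u (int t - int q) \<omega>) / real (m\<^sup>2))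
      \<longlonglongrightarrow> covariance_matrix M (\<lambda>i. u (int (idx i) - 1)) $ i $ j"
    if pq: "p \<le> q" "p \<ge> 1" "q \<le> CARD('n)" and ij: "{idx i, idx j} = {p, q}" for p q i j
  proof -
    define d where "d = q - p"
    define h' where "h' k = (if k < d then 0 else h (k - d))" for k
    have d: "int d = int q - int p" using pq by (simp add: d_def)
    have h': "summable (\<lambda>k. \<bar>h' k\<bar>)"
    proof -
      have "(\<lambda>k. \<bar>h' (k + d)\<bar>) = (\<lambda>k. \<bar>h k\<bar>)" by (simp add: h'_def)
      then show ?thesis
        using h summable_iff_shift[of "\<lambda>k. \<bar>h' k\<bar>" d] by simp
    qed
    have z: "AE \<omega> in M. (\<lambda>k. h' k * e (t - int k) \<omega>) sums u (t - int d) \<omega>"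
      if "t - int d \<ge> 1 - int CARD('n)" for t
      using u[OF that]
    proof eventually_elim
      case (elim \<omega>)
      have "(\<lambda>k. h' (k + d) * e (t - int (k + d)) \<omega>) = (\<lambda>k. h k * e (t - int d - int k) \<omega>)"
        by (simp add: h'_def algebra_simps)
      then show ?case
        using elim sums_zero_iff_shift[of d "\<lambda>k. h' k * e (t - int k) \<omega>" "u (t - int d) \<omega>"]
        by (simp add: h'_def)
    qed
    let ?T = "\<lambda>m. (\<lambda>t. int t - int p) ` {1..m\<^sup>2}"
    have inj: "inj_on (\<lambda>t. int t - int p) A" for A by (auto simp: inj_on_def)
    have T: "t \<ge> 1 - int CARD('n)" "t - int d \<ge> 1 - int CARD('n)" if "t \<in> ?T m" for t m
      using that pq by (auto simp: d)
    have "AE \<omega> in M. (\<lambda>m. (\<Sum>t\<in>?T m. u t \<omega> * u (t - int d) \<omega>) / real (m\<^sup>2))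
        \<longlonglongrightarrow> s2 * (\<Sum>k. h k * h' k)"
    proof (rule sample_covariance_limit[OF h h'])
      show "finite (?T m)" "card (?T m) = m\<^sup>2" for m
        by (simp_all add: card_image[OF inj])
      fix m t assume "t \<in> ?T m"
      note t = T[OF this]
      show "AE \<omega> in M. (\<lambda>k. h k * e (t - int k) \<omega>) sums u t \<omega>" by (rule u[OF t(1)])
      show "AE \<omega> in M. (\<lambda>k. h' k * e (t - int k) \<omega>) sums u (t - int d) \<omega>" by (rule z[OF t(2)])
      show "u t \<in> borel_measurable M" by (rule meas[OF t(1)])
      show "u (t - int d) \<in> borel_measurable M" by (rule meas[OF t(2)])
    qed
    moreover have "(\<Sum>t\<in>?T m. u t \<omega> * u (t - int d) \<omega>)
        = (\<Sum>t=1..m\<^sup>2. u (int t - int p) \<omega> * u (int t - int q) \<omega>)" for m \<omega>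
      by (subst sum.reindex[OF inj]) (simp add: d)
    moreover have "covariance_matrix M (\<lambda>i. u (int (idx i) - 1)) $ i $ j = s2 * (\<Sum>k. h k * h' k)"
    proof -
      let ?w = "u (int q - 1)" and ?z = "u (int p - 1)"
      have w: "AE \<omega> in M. (\<lambda>k. h k * e (int q - 1 - int k) \<omega>) sums ?w \<omega>"
        using pq by (intro u) auto
      have z': "AE \<omega> in M. (\<lambda>k. h' k * e (int q - 1 - int k) \<omega>) sums ?z \<omega>"
        using z[of "int q - 1"] pq by (simp add: d algebra_simps)
      have m: "?w \<in> borel_measurable M" "?z \<in> borel_measurable M"
        using pq by (auto intro!: meas)
      have "expectation (\<lambda>\<omega>. u (int (idx i) - 1) \<omega> * u (int (idx j) - 1) \<omega>) = expectation (\<lambda>\<omega>. ?w \<omega> * ?z \<omega>)"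
        using ij by (auto simp: doubleton_eq_iff mult.commute)
      moreover have "expectation (u (int (idx i) - 1)) = 0" "expectation (u (int (idx j) - 1)) = 0"
        using ij linear_process_moments(1)[OF h h' w z' m] linear_process_moments(1)[OF h' h z' w m(2,1)]
        by (auto simp: doubleton_eq_iff)
      ultimately show ?thesis
        using linear_process_moments(2)[OF h h' w z' m] by (simp add: covariance_matrix_def)
    qed
    ultimately show ?thesis by simp
  qed
  have "AE \<omega> in M. (\<lambda>m. gram idx u (m\<^sup>2) \<omega> $ i $ j / real (m\<^sup>2))
           \<longlonglongrightarrow> covariance_matrix M (\<lambda>i. u (int (idx i) - 1)) $ i $ j" for i j
  proof (cases "idx i \<le> idx j")
    case True
    then show ?thesis
      using ordered[of "idx i" "idx j" i j] idx[of i] idx[of j] by (simp add: gram_def regressor_def)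
  next
    case False
    then show ?thesis
      using ordered[of "idx j" "idx i" i j] idx[of i] idx[of j]
      by (simp add: gram_def regressor_def insert_commute mult.commute)
  qed
  then show ?thesis by (simp add: AE_all_countable)
qed

end

text \<open>
  For \<open>N\<close> between \<open>m\<^sup>2\<close> and
  \<open>(m + 1)\<^sup>2 \<le> 4 m\<^sup>2\<close> (where \<open>m \<ge> 1\<close>), monotonicity of
  the quadratic form in \<open>N\<close> transports the lower bound from \<open>m\<^sup>2\<close> to
  \<open>N\<close> with the loss of a factor 4.
\<close>
lemma gram_coercive_of_squares:
  fixes \<Sigma> :: "real^'n^'n" and idx :: "'n::finite \<Rightarrow> nat"
  assumes pd: "pos_def \<Sigma>"
    and lim: "\<And>i j. (\<lambda>m. gram idx u (m^2) \<omega> $ i $ j / real (m^2)) \<longlonglongrightarrow> \<Sigma> $ i $ j"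
  shows "\<exists>c>0. \<forall>\<^sub>F N in sequentially. \<forall>x. c * real N * (norm x)\<^sup>2 \<le> x \<bullet> (gram idx u N \<omega> *v x)"
proof -
  obtain c where c: "c > 0" "\<And>x. c * (norm x)\<^sup>2 \<le> x \<bullet> (\<Sigma> *v x)"
    using pos_def_coercive[OF pd] by blast
  define n where "n = real CARD('n)"
  have n: "n > 0" by (simp add: n_def)
  \<comment> \<open>Chosen so that the error term of \<open>quadform_ge_of_close\<close> uses up half of the coercivity
    constant.\<close>
  define \<epsilon> where "\<epsilon> = c / (2 * n\<^sup>2)"
  have \<epsilon>: "\<epsilon> > 0" "\<epsilon> * n\<^sup>2 = c / 2" using c n by (auto simp: \<epsilon>_def)
  have "\<forall>\<^sub>F m in sequentially. \<forall>i j. \<bar>gram idx u (m^2) \<omega> $ i $ j / real (m^2) - \<Sigma> $ i $ j\<bar> < \<epsilon>"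
    using tendstoD[OF lim \<epsilon>(1)] by (simp add: dist_real_def eventually_all_finite)
  then have ev: "\<forall>\<^sub>F m in sequentially. \<forall>x. c / 2 * real (m^2) * (norm x)\<^sup>2 \<le> x \<bullet> (gram idx u (m^2) \<omega> *v x)"
    using eventually_gt_at_top[of 0]
  proof eventually_elim
    case (elim m)
    show ?case
    proof
      fix x :: "real^'n"
      let ?A = "(1 / real (m^2)) *\<^sub>R gram idx u (m^2) \<omega>"
      have "x \<bullet> (\<Sigma> *v x) - \<epsilon> * n\<^sup>2 * (norm x)\<^sup>2 \<le> x \<bullet> (?A *v x)"
        unfolding n_def by (rule quadform_ge_of_close) (use elim(1) in \<open>auto intro: less_imp_le\<close>)
      also have "\<dots> = x \<bullet> (gram idx u (m^2) \<omega> *v x) / real (m^2)"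
        by (simp add: scaleR_matrix_vector_assoc[symmetric])
      finally have "c / 2 * (norm x)\<^sup>2 \<le> x \<bullet> (gram idx u (m^2) \<omega> *v x) / real (m^2)"
        using c(2)[of x] unfolding \<epsilon>(2) by linarith
      then show "c / 2 * real (m^2) * (norm x)\<^sup>2 \<le> x \<bullet> (gram idx u (m^2) \<omega> *v x)"
        using elim(2) by (simp add: field_simps)
    qed
  qed
  have "filterlim floor_sqrt at_top sequentially"
    unfolding filterlim_at_top
  proof
    fix Z show "\<forall>\<^sub>F N in sequentially. Z \<le> floor_sqrt N"
      using eventually_ge_at_top[of "Z^2"] by eventually_elim (simp add: le_floor_sqrtI)
  qed
  \<comment> \<open>The constant is \<open>c / 2\<close> from the squares, divided by the bound 4 on
    \<open>N / floor_sqrt N ^ 2\<close>.\<close>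
  from eventually_compose_filterlim[OF ev this]
  have "\<forall>\<^sub>F N in sequentially. \<forall>x. c / 8 * real N * (norm x)\<^sup>2 \<le> x \<bullet> (gram idx u N \<omega> *v x)"
    using eventually_gt_at_top[of 0]
  proof eventually_elim
    case (elim N)
    let ?m = "floor_sqrt N"
    have m: "?m^2 \<le> N" "?m > 0" "N < (Suc ?m)^2"
      using elim(2) by (simp_all only: floor_sqrt_power2_le floor_sqrt_greater_zero_iff Suc_floor_sqrt_power2_gt)
    have "Suc ?m \<le> 2 * ?m" using m(2) by linarith
    then have "(Suc ?m)^2 \<le> (2 * ?m)^2" by (rule power_mono) simp
    then have "N \<le> 4 * ?m^2" using m(3) by (simp add: power_mult_distrib)
    then have N4: "real N \<le> 4 * real (?m^2)"
      by (metis of_nat_le_iff of_nat_mult of_nat_numeral)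
    show ?case
    proof
      fix x :: "real^'n"
      have "c / 8 * real N * (norm x)\<^sup>2 \<le> c / 8 * (4 * real (?m^2)) * (norm x)\<^sup>2"
        using c(1) N4 by (intro mult_right_mono mult_left_mono) auto
      also have "\<dots> \<le> x \<bullet> (gram idx u (?m^2) \<omega> *v x)"
        using elim(1) by simp
      also have "\<dots> \<le> x \<bullet> (gram idx u N \<omega> *v x)"
        by (rule quadform_gram_mono[OF m(1)])
      finally show "c / 8 * real N * (norm x)\<^sup>2 \<le> x \<bullet> (gram idx u N \<omega> *v x)" .
    qed
  qed
  then show ?thesis using c(1) by (intro exI[of _ "c / 8"]) auto
qed

text \<open>
  The inverse of the Gram matrix is \<open>O(1 / N)\<close> and the estimated variance is at most
  \<open>2 / N\<close> times the noise energy as soon as \<open>N \<ge> 2 n\<close>. Hence the norm of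
  the second quantity is at most a constant times
  \<open>(\<Sum>t\<le>N. v(t)\<^sup>2) / N\<^bsup>3/2\<^esup>\<close>.
\<close>
lemma inv_gram_rates:
  fixes idx :: "'n::finite \<Rightarrow> nat" and \<theta>\<^sub>0 :: "real^'n"
  assumes rank: "\<And>N. N > CARD('n) \<Longrightarrow> full_column_rank idx u N \<omega>"
    and model: "\<And>t. t \<ge> 1 \<Longrightarrow> y t \<omega> = regressor idx u t \<omega> \<bullet> \<theta>\<^sub>0 + v t \<omega>"
    and coercive: "c > 0" "\<forall>\<^sub>F N in sequentially. \<forall>x. c * real N * (norm x)\<^sup>2 \<le> x \<bullet> (gram idx u N \<omega> *v x)"
    and noise: "(\<lambda>N. (\<Sum>t=1..N. (v t \<omega>)\<^sup>2) / real N powr (3/2)) \<longlonglongrightarrow> 0"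
  shows "(\<lambda>N. sqrt (real N) *\<^sub>R matrix_inv (gram idx u N \<omega>)) \<longlonglongrightarrow> 0"
    and "(\<lambda>N. sqrt (real N) *\<^sub>R (noise_var_estimate idx u y N \<omega> *\<^sub>R matrix_inv (gram idx u N \<omega>))) \<longlonglongrightarrow> 0"
proof -
  define n where "n = real CARD('n)"
  have n: "n > 0" by (simp add: n_def)
  let ?G = "\<lambda>N. matrix_inv (gram idx u N \<omega>)"
  have G: "\<forall>\<^sub>F N in sequentially. sqrt (real N) * norm (?G N) \<le> n * n / c * (1 / sqrt (real N))"
    using coercive(2) eventually_gt_at_top[of 0]
  proof eventually_elim
    case (elim N)
    have "norm (?G N) \<le> n * n / (c * real N)"
      unfolding n_def using elim coercive(1) by (intro norm_matrix_inv_le) auto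
    then have "sqrt (real N) * norm (?G N) \<le> sqrt (real N) * (n * n / (c * real N))"
      by (intro mult_left_mono) auto
    also have "\<dots> = n * n / c * (sqrt (real N) / real N)" by simp
    also have "sqrt (real N) / real N = 1 / sqrt (real N)"
      using elim(2) by (simp add: field_simps)
    finally show ?case .
  qed
  show "(\<lambda>N. sqrt (real N) *\<^sub>R ?G N) \<longlonglongrightarrow> 0"
  proof (rule Lim_null_comparison)
    show "\<forall>\<^sub>F N in sequentially. norm (sqrt (real N) *\<^sub>R ?G N) \<le> n * n / c * (1 / sqrt (real N))"
      using G by simp
    have "(\<lambda>N. 1 / sqrt (real N)) \<longlonglongrightarrow> 0"
      by (intro real_tendsto_divide_at_top[OF tendsto_const] filterlim_compose[OF sqrt_at_top]
          filterlim_real_sequentially)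
    then show "(\<lambda>N. n * n / c * (1 / sqrt (real N))) \<longlonglongrightarrow> 0"
      by (rule tendsto_mult_right_zero)
  qed
  let ?s = "\<lambda>N. noise_var_estimate idx u y N \<omega>" and ?V = "\<lambda>N. \<Sum>t=1..N. (v t \<omega>)\<^sup>2"
  show "(\<lambda>N. sqrt (real N) *\<^sub>R (?s N *\<^sub>R ?G N)) \<longlonglongrightarrow> 0"
  proof (rule Lim_null_comparison)
    show "\<forall>\<^sub>F N in sequentially. norm (sqrt (real N) *\<^sub>R (?s N *\<^sub>R ?G N))
        \<le> 2 * (n * n / c) * (?V N / real N powr (3/2))"
      using G eventually_ge_at_top[of "2 * CARD('n)"]
    proof eventually_elim
      case (elim N)
      have "CARD('n) > 0" by simp
      then have N: "N > CARD('n)" "N > 0" using elim(2) by linarith+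
      have N2: "real N - n \<ge> real N / 2" using elim(2) unfolding n_def by linarith
      have s0: "?s N \<ge> 0" by (rule noise_var_estimate_nonneg[OF N(1)])
      have "?s N \<le> ?V N / (real N - n)"
        unfolding n_def by (rule noise_var_estimate_le[where \<theta>\<^sub>0 = \<theta>\<^sub>0]) (use N rank model in auto)
      also have "\<dots> \<le> ?V N / (real N / 2)"
        using N N2 by (intro divide_left_mono sum_nonneg mult_pos_pos) auto
      finally have s: "?s N \<le> 2 * ?V N / real N" by (simp add: mult.commute)
      have "norm (sqrt (real N) *\<^sub>R (?s N *\<^sub>R ?G N)) = ?s N * (sqrt (real N) * norm (?G N))"
        using s0 by simp
      also have "\<dots> \<le> (2 * ?V N / real N) * (n * n / c * (1 / sqrt (real N)))"
        by (rule mult_mono[OF s elim(1)]) (auto intro!: divide_nonneg_nonneg sum_nonneg)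
      also have "\<dots> = 2 * (n * n / c) * (?V N / (real N * sqrt (real N)))"
        by (simp add: ac_simps)
      also have "real N * sqrt (real N) = real N powr (3/2)"
        using N(2) powr_add[of "real N" 1 "1/2"] by (simp add: powr_half_sqrt)
      finally show ?case .
    qed
    show "(\<lambda>N. 2 * (n * n / c) * (?V N / real N powr (3/2))) \<longlonglongrightarrow> 0"
      by (rule tendsto_mult_right_zero[OF noise])
  qed
qed

section \<open>Asymptotics of the regularized inverse\<close>

theorem theorem7:
  fixes M :: "'a measure"
    and u e :: "int \<Rightarrow> 'a \<Rightarrow> real"
    and v y :: "nat \<Rightarrow> 'a \<Rightarrow> real"
    and h :: "nat \<Rightarrow> real"
    and \<theta>\<^sub>0 :: "real ^ 'n"
    and idx :: "'n::finite \<Rightarrow> nat"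
    and \<kappa> :: "nat \<Rightarrow> nat \<Rightarrow> real ^ 'p \<Rightarrow> real"
    and P :: "real ^ 'p \<Rightarrow> real ^ 'n ^ 'n"
    and \<Omega> :: "(real ^ 'p::finite) set"
    and \<sigma> \<sigma>\<^sub>e c :: real
  assumes prob: "prob_space M"
    and idx: "bij_betw idx UNIV {1..CARD('n)}"
    \<comment> \<open>model\<close>
    and model: "\<And>t \<omega>. t \<ge> 1 \<Longrightarrow> \<omega> \<in> space M \<Longrightarrow>
          y t \<omega> = (\<Sum>i\<in>UNIV. \<theta>\<^sub>0 $ i * u (int t - int (idx i)) \<omega>) + v t \<omega>"
    and rank: "AE \<omega> in M. \<forall>N>CARD('n). full_column_rank idx u N \<omega>"
    \<comment> \<open>input\<close>
    and h: "summable (\<lambda>k. \<bar>h k\<bar>)"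
    and u: "\<And>t. t \<ge> 1 - int CARD('n) \<Longrightarrow>
          AE \<omega> in M. (\<lambda>k. h k * e (t - int k) \<omega>) sums u t \<omega>"
    and e_iid: "iid M e UNIV"
    and e_mean: "\<And>t. prob_space.expectation M (e t) = 0"
    and \<sigma>\<^sub>e: "\<sigma>\<^sub>e > 0"
    and e_var: "\<And>t. prob_space.variance M (e t) = \<sigma>\<^sub>e\<^sup>2"
    and e_moments: "\<exists>\<delta>>0. bounded_moments M e UNIV (4 + \<delta>)"
    and e_fourth: "\<And>t. prob_space.expectation M (\<lambda>\<omega>. e t \<omega> ^ 4) = c * \<sigma>\<^sub>e ^ 4"
    and u_cov: "pos_def (covariance_matrix M (\<lambda>i. u (int (idx i) - 1)))"
    \<comment> \<open>noise\<close>
    and v_iid: "iid M v {1..}"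
    and v_mean: "\<And>t. t \<ge> 1 \<Longrightarrow> prob_space.expectation M (v t) = 0"
    and \<sigma>: "\<sigma> > 0"
    and v_var: "\<And>t. t \<ge> 1 \<Longrightarrow> prob_space.variance M (v t) = \<sigma>\<^sup>2"
    and v_moments: "\<exists>\<delta>>0. bounded_moments M v {1..} (4 + \<delta>)"
    and indep: "\<And>i j. i \<ge> 1 - int CARD('n) \<Longrightarrow> j \<ge> 1 \<Longrightarrow>
          prob_space.indep_var M borel (u i) borel (v j)"
    \<comment> \<open>kernel matrix\<close>
    and kernel: "\<And>\<eta>. \<eta> \<in> \<Omega> \<Longrightarrow> psd_kernel_on {1..} (\<lambda>i j. \<kappa> i j \<eta>)"
    and P: "\<And>\<eta>. P \<eta> = (\<chi> i j. \<kappa> (idx i) (idx j) \<eta>)"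
  shows
    \<comment> \<open>part 1\<close>
    "(AE \<omega> in M. (\<lambda>N. sqrt (real N) *\<^sub>R matrix_inv (gram idx u N \<omega>)) \<longlonglongrightarrow> 0) \<and>
     (\<forall>\<eta>\<in>\<Omega>. invertible (P \<eta>) \<longrightarrow>
        (AE \<omega> in M. (\<lambda>N. matrix_inv (S_hat P idx u y N \<omega> \<eta>)) \<longlonglongrightarrow> matrix_inv (P \<eta>)) \<and>
        (AE \<omega> in M. (\<lambda>N. sqrt (real N) *\<^sub>R
            (matrix_inv (S_hat P idx u y N \<omega> \<eta>) - matrix_inv (P \<eta>))) \<longlonglongrightarrow> 0) \<and>
        (P differentiable (at \<eta>) \<longrightarrow> (\<forall>k.
          (AE \<omega> in M. (\<lambda>N. partial k (\<lambda>x. matrix_inv (S_hat P idx u y N \<omega> x)) \<eta>)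
             \<longlonglongrightarrow> partial k (\<lambda>x. matrix_inv (P x)) \<eta>) \<and>
          (AE \<omega> in M. (\<lambda>N. sqrt (real N) *\<^sub>R
             (partial k (\<lambda>x. matrix_inv (S_hat P idx u y N \<omega> x)) \<eta>
               - partial k (\<lambda>x. matrix_inv (P x)) \<eta>)) \<longlonglongrightarrow> 0)))) \<and>
     \<comment> \<open>part 2\<close>
     (\<forall>\<eta>h \<eta>s \<Omega>'.
        (AE \<omega> in M. \<forall>N>CARD('n). \<eta>h N \<omega> \<in> \<Omega>) \<and>
        (AE \<omega> in M. (\<lambda>N. \<eta>h N \<omega>) \<longlonglongrightarrow> \<eta>s) \<and>
        compact \<Omega>' \<and> \<eta>s \<in> \<Omega>' \<and> \<Omega>' \<subseteq> \<Omega> \<and>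
        (\<forall>\<eta>\<in>\<Omega>'. continuous (at \<eta> within \<Omega>) P \<and> invertible (P \<eta>)) \<and>
        (\<exists>B>0. AE \<omega> in M. \<forall>N>CARD('n). \<forall>\<eta>\<in>\<Omega>'.
           norm (matrix_inv (S_hat P idx u y N \<omega> \<eta>)) < norm (matrix_inv (P \<eta>)) \<and>
           norm (matrix_inv (P \<eta>)) \<le> B) \<longrightarrow>
        (AE \<omega> in M. (\<lambda>N. matrix_inv (S_hat P idx u y N \<omega> (\<eta>h N \<omega>))) \<longlonglongrightarrow> matrix_inv (P \<eta>s))) \<and>
     \<comment> \<open>part 3\<close>
     (\<forall>\<eta>h \<eta>s.
        (AE \<omega> in M. (\<lambda>N. \<eta>h N \<omega>) \<longlonglongrightarrow> \<eta>s) \<and> (\<forall>\<eta>\<in>\<Omega>. P differentiable (at \<eta>)) \<and>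
        invertible (P \<eta>s) \<longrightarrow>
        (\<forall>\<omega>\<in>space M. \<forall>N>CARD('n).
          full_column_rank idx u N \<omega> \<and>
          closed_segment \<eta>s (\<eta>h N \<omega>) \<subseteq> \<Omega> \<and>
          invertible (S_hat P idx u y N \<omega> (\<eta>h N \<omega>)) \<longrightarrow>
          (\<exists>\<eta>t :: 'n \<Rightarrow> 'n \<Rightarrow> real ^ 'p.
            (\<forall>i j. \<eta>t i j \<in> \<Omega> \<inter> cball \<eta>s (norm (\<eta>h N \<omega> - \<eta>s))) \<and>
            matrix_inv (S_hat P idx u y N \<omega> (\<eta>h N \<omega>)) - matrix_inv (P \<eta>s) =
              - (matrix_inv (S_hat P idx u y N \<omega> (\<eta>h N \<omega>))
                  ** (\<chi> i j. \<Sum>k\<in>UNIV.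
                        partial k P (\<eta>t i j) $ i $ j * (axis k 1 \<bullet> (\<eta>h N \<omega> - \<eta>s)))
                  ** matrix_inv (P \<eta>s))
              - noise_var_estimate idx u y N \<omega> *\<^sub>R
                  (matrix_inv (S_hat P idx u y N \<omega> (\<eta>h N \<omega>))
                    ** matrix_inv (gram idx u N \<omega>) ** matrix_inv (P \<eta>s))))) \<and>
     (\<forall>(\<eta>h :: nat \<Rightarrow> 'a \<Rightarrow> real) \<eta>s :: real.
        (AE \<omega> in M. (\<lambda>N. \<eta>h N \<omega>) \<longlonglongrightarrow> \<eta>s) \<and> \<eta>s > 0 \<longrightarrow>
        (let Q = (\<lambda>\<eta>. \<eta> *\<^sub>R (mat 1 :: real ^ 'n ^ 'n)) in
         \<forall>\<omega>\<in>space M. \<forall>N>CARD('n). full_column_rank idx u N \<omega> \<and> \<eta>h N \<omega> > 0 \<longrightarrow>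
          matrix_inv (S_hat Q idx u y N \<omega> (\<eta>h N \<omega>)) - matrix_inv (Q \<eta>s) =
            - ((\<eta>h N \<omega> - \<eta>s) *\<^sub>R
                 (matrix_inv (S_hat Q idx u y N \<omega> (\<eta>h N \<omega>)) ** matrix_inv (Q \<eta>s)))
            - noise_var_estimate idx u y N \<omega> *\<^sub>R
                (matrix_inv (S_hat Q idx u y N \<omega> (\<eta>h N \<omega>))
                  ** matrix_inv (gram idx u N \<omega>) ** matrix_inv (Q \<eta>s)))) \<and>
     \<comment> \<open>part 4\<close>
     (\<forall>\<eta>\<in>\<Omega>. invertible (P \<eta>) \<longrightarrow>
        (\<forall>\<omega>\<in>space M. \<forall>N>CARD('n). full_column_rank idx u N \<omega> \<longrightarrow>
           invertible (S_hat P idx u y N \<omega> \<eta>) \<and>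
           matrix_inv (S_hat P idx u y N \<omega> \<eta>) - matrix_inv (P \<eta>) =
             - ((1 / real N * noise_var_estimate idx u y N \<omega>) *\<^sub>R
                  (matrix_inv (S_hat P idx u y N \<omega> \<eta>)
                    ** (real N *\<^sub>R matrix_inv (gram idx u N \<omega>)) ** matrix_inv (P \<eta>)))) \<and>
        (P differentiable (at \<eta>) \<longrightarrow> (\<forall>k.
           partial k (\<lambda>x. matrix_inv (P x)) \<eta> =
             - (matrix_inv (P \<eta>) ** partial k P \<eta> ** matrix_inv (P \<eta>)))) \<and>
        (twice_differentiable_at P \<eta> \<longrightarrow> (\<forall>k l.
           partial k (partial l (\<lambda>x. matrix_inv (P x))) \<eta> =
             matrix_inv (P \<eta>) ** partial l P \<eta> ** matrix_inv (P \<eta>)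
               ** partial k P \<eta> ** matrix_inv (P \<eta>)
             - matrix_inv (P \<eta>) ** partial k (partial l P) \<eta> ** matrix_inv (P \<eta>)
             + matrix_inv (P \<eta>) ** partial k P \<eta> ** matrix_inv (P \<eta>)
               ** partial l P \<eta> ** matrix_inv (P \<eta>)))) \<and>
     (\<forall>\<eta>\<in>\<Omega>. \<forall>\<omega>\<in>space M. \<forall>N>CARD('n).
        full_column_rank idx u N \<omega> \<and> invertible (S_hat P idx u y N \<omega> \<eta>) \<longrightarrow>
        (let S = S_hat P idx u y N \<omega> in
         (P differentiable (at \<eta>) \<longrightarrow> (\<forall>k.
            partial k (\<lambda>x. matrix_inv (S x)) \<eta> =
              - (matrix_inv (S \<eta>) ** partial k P \<eta> ** matrix_inv (S \<eta>)))) \<and>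
         (twice_differentiable_at P \<eta> \<longrightarrow> (\<forall>k l.
            partial k (partial l (\<lambda>x. matrix_inv (S x))) \<eta> =
              matrix_inv (S \<eta>) ** partial l P \<eta> ** matrix_inv (S \<eta>)
                ** partial k P \<eta> ** matrix_inv (S \<eta>)
              - matrix_inv (S \<eta>) ** partial k (partial l P) \<eta> ** matrix_inv (S \<eta>)
              + matrix_inv (S \<eta>) ** partial k P \<eta> ** matrix_inv (S \<eta>)
                ** partial l P \<eta> ** matrix_inv (S \<eta>)))))"
proof -
  interpret prob_space M by (rule prob)
  interpret noise: white_noise M e "\<sigma>\<^sub>e\<^sup>2" "c * \<sigma>\<^sub>e ^ 4"
  proof unfold_locales
    show ind: "indep_vars (\<lambda>_. borel) e UNIV"
      using e_iid by (simp add: iid_def)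
    fix t
    have "e t \<in> borel_measurable M"
      using ind by (simp add: indep_vars_def)
    then show "integrable M (\<lambda>\<omega>. e t \<omega> ^ 4)"
      using e_moments by (auto intro: integrable_power_of_bounded_moments[OF prob])
    show "expectation (\<lambda>\<omega>. (e t \<omega>)\<^sup>2) = \<sigma>\<^sub>e\<^sup>2"
      using e_var[of t] by (simp add: e_mean)
  qed (fact e_mean e_fourth)+

  let ?G = "\<lambda>N \<omega>. matrix_inv (gram idx u N \<omega>)"
  let ?s = "\<lambda>N \<omega>. noise_var_estimate idx u y N \<omega>"
  let ?S = "\<lambda>N \<omega> \<eta>. S_hat P idx u y N \<omega> \<eta>"

  have meas_u: "u t \<in> borel_measurable M" if "t \<ge> 1 - int CARD('n)" for t
    using indep[OF that, of 1] by (auto dest: indep_var_rv1)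
  have idx_range: "idx i \<in> {1..CARD('n)}" for i
    using bij_betw_apply[OF idx] by simp
  \<comment> \<open>Outside a null set the Gram matrix grows at least linearly and the noise energy is
    \<open>o(N\<^bsup>3/2\<^esup>)\<close>. For each such outcome the two rates follow.\<close>
  have AE_coercive: "AE \<omega> in M. \<exists>c>0. \<forall>\<^sub>F N in sequentially.
      \<forall>x. c * real N * (norm x)\<^sup>2 \<le> x \<bullet> (gram idx u N \<omega> *v x)"
  proof -
    have "AE \<omega> in M. \<forall>i j. (\<lambda>m. gram idx u (m\<^sup>2) \<omega> $ i $ j / real (m\<^sup>2))
        \<longlonglongrightarrow> covariance_matrix M (\<lambda>i. u (int (idx i) - 1)) $ i $ j"
      using idx_range h u meas_u by (rule noise.AE_gram_limit)
    then show ?thesis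
      by eventually_elim (rule gram_coercive_of_squares[OF u_cov], blast)
  qed

  have meas_v: "v t \<in> borel_measurable M" if "t \<ge> 1" for t
    using v_iid that by (simp add: iid_def indep_vars_def)
  have "(\<integral>\<^sup>+\<omega>. ennreal ((v t \<omega>)\<^sup>2) \<partial>M) \<le> ennreal (\<sigma>\<^sup>2)" if t: "t \<ge> 1" for t
  proof -
    have "integrable M (\<lambda>\<omega>. (v t \<omega>)\<^sup>2)"
      using v_moments t meas_v[OF t] by (auto intro: integrable_power_of_bounded_moments[OF prob])
    then show ?thesis
      using v_var[OF t] by (subst nn_integral_eq_integral) (auto simp: v_mean[OF t])
  qed
  then have AE_noise: "AE \<omega> in M. (\<lambda>N. (\<Sum>t=1..N. (v t \<omega>)\<^sup>2) / real N powr (3/2)) \<longlonglongrightarrow> 0"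
    by (intro AE_sum_squares_negligible[where C = "\<sigma>\<^sup>2"] meas_v) auto

  have rates: "AE \<omega> in M. (\<lambda>N. sqrt (real N) *\<^sub>R ?G N \<omega>) \<longlonglongrightarrow> 0
      \<and> (\<lambda>N. sqrt (real N) *\<^sub>R (?s N \<omega> *\<^sub>R ?G N \<omega>)) \<longlonglongrightarrow> 0"
    using rank AE_coercive AE_noise AE_space
  proof eventually_elim
    case (elim \<omega>)
    have model': "y t \<omega> = regressor idx u t \<omega> \<bullet> \<theta>\<^sub>0 + v t \<omega>" if "t \<ge> 1" for t
      using model[OF that elim(4)] by (simp add: regressor_def inner_vec_def mult.commute)
    have rank': "full_column_rank idx u N \<omega>" if "N > CARD('n)" for N
      using elim(1) that by blast
    obtain c where c: "c > 0" "\<forall>\<^sub>F N in sequentially. \<forall>x. c * real N * (norm x)\<^sup>2 \<le> x \<bullet> (gram idx u N \<omega> *v x)"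
      using elim(2) by blast
    from inv_gram_rates[where idx = idx and u = u and y = y and v = v and \<theta>\<^sub>0 = \<theta>\<^sub>0 and \<omega> = \<omega>,
        OF rank' model' c elim(3)]
    show ?case by blast
  qed

  have psd: "0 \<le> x \<bullet> (P \<eta> *v x)" if "\<eta> \<in> \<Omega>" for x \<eta>
    unfolding P by (rule kernel_matrix_quadform_nonneg[OF idx kernel[OF that]])
  have inv_S: "invertible (?S N \<omega> \<eta>)"
    if "\<eta> \<in> \<Omega>" "invertible (P \<eta>)" "CARD('n) < N" "full_column_rank idx u N \<omega>" for N \<omega> \<eta>
    by (rule invertible_S_hat[where P = P and \<eta> = \<eta>, OF that(3,4) psd[OF that(1)] that(2)])
  have AE_limits: "AE \<omega> in M. (\<lambda>N. matrix_inv (?S N \<omega> \<eta>)) \<longlonglongrightarrow> matrix_inv (P \<eta>)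
      \<and> (\<lambda>N. sqrt (real N) *\<^sub>R (matrix_inv (?S N \<omega> \<eta>) - matrix_inv (P \<eta>))) \<longlonglongrightarrow> 0
      \<and> (\<forall>\<^sub>F N in sequentially. invertible (?S N \<omega> \<eta>))"
    if "invertible (P \<eta>)" for \<eta>
    using rates
  proof eventually_elim
    case (elim \<omega>)
    then show ?case
      using matrix_inv_perturbation_limit(1-3)[OF that, of "\<lambda>N. ?s N \<omega> *\<^sub>R ?G N \<omega>"]
      by (simp add: S_hat_def)
  qed
  have partial_inv_S: "partial k (\<lambda>x. matrix_inv (?S N \<omega> x)) \<eta> =
      - (matrix_inv (?S N \<omega> \<eta>) ** partial k P \<eta> ** matrix_inv (?S N \<omega> \<eta>))"
    if "P differentiable (at \<eta>)" "invertible (?S N \<omega> \<eta>)" for N \<omega> \<eta> k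
    using partial_matrix_inv[OF differentiable_S_hat[OF that(1)] that(2)]
    by (simp add: partial_S_hat)

  have part1_inv: "AE \<omega> in M. (\<lambda>N. matrix_inv (?S N \<omega> \<eta>)) \<longlonglongrightarrow> matrix_inv (P \<eta>)"
    if "invertible (P \<eta>)" for \<eta>
    using AE_limits[OF that] by eventually_elim simp
  have part1_rate: "AE \<omega> in M. (\<lambda>N. sqrt (real N) *\<^sub>R
      (matrix_inv (?S N \<omega> \<eta>) - matrix_inv (P \<eta>))) \<longlonglongrightarrow> 0" if "invertible (P \<eta>)" for \<eta>
    using AE_limits[OF that] by eventually_elim simp
  have part1_partial: "AE \<omega> in M. (\<lambda>N. partial k (\<lambda>x. matrix_inv (?S N \<omega> x)) \<eta>)
      \<longlonglongrightarrow> partial k (\<lambda>x. matrix_inv (P x)) \<eta>"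
    if inv: "invertible (P \<eta>)" and diff: "P differentiable (at \<eta>)" for \<eta> k
    using AE_limits[OF inv]
  proof eventually_elim
    case (elim \<omega>)
    let ?X = "\<lambda>N. matrix_inv (?S N \<omega> \<eta>)"
    have "(\<lambda>N. - (?X N ** partial k P \<eta> ** ?X N))
        \<longlonglongrightarrow> - (matrix_inv (P \<eta>) ** partial k P \<eta> ** matrix_inv (P \<eta>))"
      using elim by (intro tendsto_minus tendsto_matrix_mult tendsto_const) auto
    moreover have "\<forall>\<^sub>F N in sequentially. - (?X N ** partial k P \<eta> ** ?X N)
        = partial k (\<lambda>x. matrix_inv (?S N \<omega> x)) \<eta>"
      using elim by (auto simp: partial_inv_S[OF diff] elim: eventually_mono)
    ultimately show ?case
      unfolding partial_matrix_inv[OF diff inv] by (rule Lim_transform_eventually)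
  qed
  have part1_partial_rate: "AE \<omega> in M. (\<lambda>N. sqrt (real N) *\<^sub>R
      (partial k (\<lambda>x. matrix_inv (?S N \<omega> x)) \<eta> - partial k (\<lambda>x. matrix_inv (P x)) \<eta>)) \<longlonglongrightarrow> 0"
    if inv: "invertible (P \<eta>)" and diff: "P differentiable (at \<eta>)" for \<eta> k
    using AE_limits[OF inv]
  proof eventually_elim
    case (elim \<omega>)
    let ?X = "\<lambda>N. matrix_inv (?S N \<omega> \<eta>)" and ?A = "matrix_inv (P \<eta>)"
    have "(\<lambda>N. - (sqrt (real N) *\<^sub>R (?X N ** partial k P \<eta> ** ?X N - ?A ** partial k P \<eta> ** ?A))) \<longlonglongrightarrow> - 0"
      using elim by (intro tendsto_minus sandwiched_product_rate) auto
    moreover have "\<forall>\<^sub>F N in sequentially.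
        - (sqrt (real N) *\<^sub>R (?X N ** partial k P \<eta> ** ?X N - ?A ** partial k P \<eta> ** ?A))
        = sqrt (real N) *\<^sub>R (partial k (\<lambda>x. matrix_inv (?S N \<omega> x)) \<eta> - partial k (\<lambda>x. matrix_inv (P x)) \<eta>)"
      using elim unfolding partial_matrix_inv[OF diff inv]
      by (auto simp: partial_inv_S[OF diff] scaleR_diff_right elim!: eventually_mono)
    ultimately show ?case by (simp add: Lim_transform_eventually)
  qed

  have part2: "AE \<omega> in M. (\<lambda>N. matrix_inv (?S N \<omega> (\<eta>h N \<omega>))) \<longlonglongrightarrow> matrix_inv (P \<eta>s)"
    if "AE \<omega> in M. \<forall>N>CARD('n). \<eta>h N \<omega> \<in> \<Omega>" "AE \<omega> in M. (\<lambda>N. \<eta>h N \<omega>) \<longlonglongrightarrow> \<eta>s"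
      and cont: "continuous (at \<eta>s within \<Omega>) P" and inv: "invertible (P \<eta>s)" for \<eta>h \<eta>s
    using that(1,2) rates
  proof eventually_elim
    case (elim \<omega>)
    have "\<forall>\<^sub>F N in sequentially. \<eta>h N \<omega> \<in> \<Omega>"
      using eventually_gt_at_top[of "CARD('n)"] by eventually_elim (use elim(1) in blast)
    then have "(\<lambda>N. P (\<eta>h N \<omega>)) \<longlonglongrightarrow> P \<eta>s"
      by (rule continuous_within_tendsto_compose[OF cont _ elim(2)])
    moreover have "(\<lambda>N. ?s N \<omega> *\<^sub>R ?G N \<omega>) \<longlonglongrightarrow> 0"
      by (rule matrix_inv_perturbation_limit(4)[OF inv conjunct2[OF elim(3)]])
    ultimately have "(\<lambda>N. ?S N \<omega> (\<eta>h N \<omega>)) \<longlonglongrightarrow> P \<eta>s + 0"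
      unfolding S_hat_def by (rule tendsto_add)
    then have "(\<lambda>N. ?S N \<omega> (\<eta>h N \<omega>)) \<longlonglongrightarrow> P \<eta>s" by simp
    then show ?case using inv by (rule tendsto_matrix_inv)
  qed

  have part3: "\<exists>\<eta>t :: 'n \<Rightarrow> 'n \<Rightarrow> real ^ 'p.
      (\<forall>i j. \<eta>t i j \<in> \<Omega> \<inter> cball \<eta>s (norm (\<eta> - \<eta>s))) \<and>
      matrix_inv (?S N \<omega> \<eta>) - matrix_inv (P \<eta>s) =
        - (matrix_inv (?S N \<omega> \<eta>)
            ** (\<chi> i j. \<Sum>k\<in>UNIV. partial k P (\<eta>t i j) $ i $ j * (axis k 1 \<bullet> (\<eta> - \<eta>s)))
            ** matrix_inv (P \<eta>s))
        - ?s N \<omega> *\<^sub>R (matrix_inv (?S N \<omega> \<eta>) ** ?G N \<omega> ** matrix_inv (P \<eta>s))"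
    if diff: "\<forall>\<eta>\<in>\<Omega>. P differentiable (at \<eta>)" and inv: "invertible (P \<eta>s)"
      and seg: "closed_segment \<eta>s \<eta> \<subseteq> \<Omega>" and S: "invertible (?S N \<omega> \<eta>)" for N \<omega> \<eta> \<eta>s
  proof -
    obtain z where z: "\<And>i j. z i j \<in> closed_segment \<eta>s \<eta>"
      "P \<eta> - P \<eta>s = (\<chi> i j. \<Sum>k\<in>UNIV. partial k P (z i j) $ i $ j * (axis k 1 \<bullet> (\<eta> - \<eta>s)))"
      using mean_value_matrix[of \<eta>s \<eta> P] diff seg by blast
    \<comment> \<open>Points of a segment are no farther from one end than the other end is.\<close>
    have "z i j \<in> \<Omega> \<inter> cball \<eta>s (norm (\<eta> - \<eta>s))" for i j
      using z(1)[of i j] seg segment_bound(1)[OF z(1)[of i j]]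
      by (auto simp: dist_norm norm_minus_commute)
    then show ?thesis
      using S_hat_inv_diff[OF S inv] unfolding z(2) by blast
  qed

  have part3_ridge: "matrix_inv (S_hat (\<lambda>\<eta>. \<eta> *\<^sub>R (mat 1 :: real^'n^'n)) idx u y N \<omega> \<eta>) - matrix_inv (\<eta>s *\<^sub>R (mat 1 :: real^'n^'n)) =
      - ((\<eta> - \<eta>s) *\<^sub>R
           (matrix_inv (S_hat (\<lambda>\<eta>. \<eta> *\<^sub>R (mat 1 :: real^'n^'n)) idx u y N \<omega> \<eta>) ** matrix_inv (\<eta>s *\<^sub>R (mat 1 :: real^'n^'n))))
      - ?s N \<omega> *\<^sub>R
          (matrix_inv (S_hat (\<lambda>\<eta>. \<eta> *\<^sub>R (mat 1 :: real^'n^'n)) idx u y N \<omega> \<eta>)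
            ** ?G N \<omega> ** matrix_inv (\<eta>s *\<^sub>R (mat 1 :: real^'n^'n)))"
    if pos: "\<eta>s > 0" "\<eta> > 0" and N: "CARD('n) < N" "full_column_rank idx u N \<omega>"
    for N \<omega> and \<eta> \<eta>s :: real
  proof -
    have inv: "invertible (r *\<^sub>R (mat 1 :: real^'n^'n))" if "r > 0" for r :: real
      using that by (intro scalar_invertible) (auto simp: invertible_def intro: exI[of _ "mat 1"])
    have "invertible (S_hat (\<lambda>\<eta>. \<eta> *\<^sub>R (mat 1 :: real^'n^'n)) idx u y N \<omega> \<eta>)"
      using pos(2) by (intro invertible_S_hat N inv) (simp add: scaleR_matrix_vector_assoc[symmetric])
    from S_hat_inv_diff[OF this inv[OF pos(1)]] show ?thesis
      by (simp add: matrix_mult_scaleR_left matrix_mult_scaleR_right flip: scaleR_diff_left)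
  qed

  have part4_diff: "matrix_inv (?S N \<omega> \<eta>) - matrix_inv (P \<eta>) =
      - ((1 / real N * ?s N \<omega>) *\<^sub>R (matrix_inv (?S N \<omega> \<eta>) ** (real N *\<^sub>R ?G N \<omega>) ** matrix_inv (P \<eta>)))"
    if "\<eta> \<in> \<Omega>" "invertible (P \<eta>)" "CARD('n) < N" "full_column_rank idx u N \<omega>" for N \<omega> \<eta>
    using S_hat_inv_diff[OF inv_S[OF that] that(2)] that(3)
    by (simp add: matrix_mult_scaleR_left matrix_mult_scaleR_right)
  have part4_second: "partial k (partial l (\<lambda>x. matrix_inv (?S N \<omega> x))) \<eta> =
      matrix_inv (?S N \<omega> \<eta>) ** partial l P \<eta> ** matrix_inv (?S N \<omega> \<eta>)
        ** partial k P \<eta> ** matrix_inv (?S N \<omega> \<eta>)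
      - matrix_inv (?S N \<omega> \<eta>) ** partial k (partial l P) \<eta> ** matrix_inv (?S N \<omega> \<eta>)
      + matrix_inv (?S N \<omega> \<eta>) ** partial k P \<eta> ** matrix_inv (?S N \<omega> \<eta>)
        ** partial l P \<eta> ** matrix_inv (?S N \<omega> \<eta>)"
    if "twice_differentiable_at P \<eta>" "invertible (?S N \<omega> \<eta>)" for N \<omega> \<eta> k l
    using partial_partial_matrix_inv[OF twice_differentiable_S_hat[OF that(1)] that(2)]
    by (simp add: partial_S_hat)

  have part1_gram: "AE \<omega> in M. (\<lambda>N. sqrt (real N) *\<^sub>R ?G N \<omega>) \<longlonglongrightarrow> 0"
    using rates by eventually_elim simp
  show ?thesis
    unfolding Let_def
    by (intro conjI ballI allI impI; (elim conjE)?;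
        ((rule part1_gram) | (rule part1_inv; assumption) | (rule part1_rate; assumption)
         | (rule part1_partial; assumption) | (rule part1_partial_rate; assumption)
         | (rule part2; blast) | (rule part3; assumption) | (rule part3_ridge; assumption)
         | (rule inv_S; assumption) | (rule part4_diff; assumption)
         | (rule partial_matrix_inv; assumption) | (rule partial_partial_matrix_inv; assumption)
         | (rule partial_inv_S; assumption) | (rule part4_second; assumption)))
qed

end
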